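(* Let $\mathbb{G}$ be a Carnot group of rank $m$ and let $\Omega\subseteq\mathbb{G}$ be a bounded domain. Let $H:\Omega\times\mathbb{R}^m\to\mathbb{R}$ be a Hamiltonian satisfying (H), let $u\in C(\overline\Omega)$ be a Monge subsolution to $H(x,Xu)=0$ in $\Omega$ and let $v\in C(\overline\Omega)$ be a Monge supersolution to $H(x,Xv)=0$ in $\Omega$. If $u\le v$ on $\partial\Omega$, then $u\le v$ in $\Omega$.
   Context: Carnot groups. A Carnot group $\mathbb{G}$ of dimension $n$, rank $m$ and step $k$ is a connected, simply connected $n$-dimensional Lie group whose Lie algebra $\mathfrak g$ of left-invariant vector fields is stratified: $\mathfrak g=\mathfrak g_1\oplus\dots\oplus\mathfrak g_k$, $[\mathfrak g_1,\mathfrak g_i]=\mathfrak g_{i+1}$ for $i<k$, $\mathfrak g_k\neq\{0\}$, $[\mathfrak g_1,\mathfrak g_k]=\{0\}$, with $\dim\mathfrak g_1=m$. An adapted basis $X_1,\dots,X_n$ of $\mathfrak g$ is fixed (consecutive blocks are bases of $\mathfrak g_1,\dots,\mathfrak g_k$), and $\mathbb{G}$ is identified with $\mathbb{R}^n$ via exponential coordinates $(y_1,\dots,y_n)\mapsto\exp(y_1X_1+\dots+y_nX_n)$. A domain is an open connected set. Horizontal curves. An absolutely continuous curve $\gamma:[0,T]\to\mathbb{G}$ is horizontal if there is $a=(a_1,\dots,a_m)\in L^\infty((0,T),\mathbb{R}^m)$ with $\dot\gamma(t)=\sum_{i=1}^m a_i(t)X_i(\gamma(t))$ for a.e. $t$;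 one then identifies $\dot\gamma(t)$ with $a(t)\in\mathbb{R}^m$. It is sub-unit if $\|a\|_\infty\le1$. The Carnot–Carathéodory distance on a domain $\Omega$ is $d_\Omega(x,y)=\inf\{\int_0^T|\dot\gamma(t)|\,dt:\ \gamma:[0,T]\to\Omega\text{ sub-unit},\ T>0,\ \gamma(0)=x,\ \gamma(T)=y\}$. Assumptions (H) on $H:\Omega\times\mathbb{R}^m\to\mathbb{R}$: (H1) $H$ is Borel measurable; (H2) for every $x\in\Omega$ the set $Z(x)=\{p\in\mathbb{R}^m: H(x,p)\le0\}$ is closed and convex and $\partial Z(x)=\{p\in\mathbb{R}^m:H(x,p)=0\}$; (H3) there is $\alpha>1$ such that $\hat B_{1/\alpha}(0)\subset Z(x)\subset\hat B_\alpha(0)$ for every $x\in\Omega$, where $\hat B_\rho(0)$ is the open Euclidean ball of radius $\rho$ in $\mathbb{R}^m$. Optical length. $\sigma^\star(x,p)=\sup\{\langle-\xi,p\rangle:\xi\in Z(x)\}$ for $x\in\Omega$, $p\in\mathbb{R}^m$, and $d_{\sigma^\star}(x,y)=\inf\{\int_0^1\sigma^\star(\gamma(t),\dot\gamma(t))\,dt:\ \gamma:[0,1]\to\Omega\text{ horizontal},\ \gamma(0)=x,\ \gamma(1)=y\}$. Monge solutions. A function $u$ continuous on $\Omega$ is a Monge subsolution (resp. supersolution) to $H(x,Xu)=0$ in $\Omega$ if for every $x_0\in\Omega$, $\liminf_{x\to x_0}\frac{u(x)-u(x_0)+d_{\sigma^\star}(x_0,x)}{d_\Omega(x_0,x)}\ge0$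 (resp. $\le0$). *)

theory Defs
  imports
    "HOL-Analysis.Analysis"
    "HOL-Algebra.Group"
    "HOL-Library.Function_Algebras"
begin

subsection \<open>Smooth maps and vector fields\<close>

primrec C_k :: "nat \<Rightarrow> ('a::euclidean_space \<Rightarrow> 'b::euclidean_space) \<Rightarrow> bool" where
  "C_k 0 f \<longleftrightarrow> continuous_on UNIV f"
| "C_k (Suc k) f \<longleftrightarrow>
     (\<forall>x. f differentiable (at x)) \<and> (\<forall>v. C_k k (\<lambda>x. frechet_derivative f (at x) v))"

definition smooth :: "('a::euclidean_space \<Rightarrow> 'b::euclidean_space) \<Rightarrow> bool" where
  "smooth f \<longleftrightarrow> (\<forall>k. C_k k f)"

type_synonym 'n vfield = "real^'n \<Rightarrow> real^'n"

definition vf_scale :: "real \<Rightarrow> 'n vfield \<Rightarrow> 'n::finite vfield" where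
  "vf_scale c V = (\<lambda>x. c *\<^sub>R V x)"

text \<open>Spans and linear independence of vector fields are over the reals, with pointwise operations.\<close>

global_interpretation vf: vector_space "vf_scale :: real \<Rightarrow> 'n vfield \<Rightarrow> 'n::finite vfield"
  by unfold_locales
    (auto simp: vf_scale_def fun_eq_iff scaleR_add_right scaleR_add_left)

definition lie_bracket :: "'n vfield \<Rightarrow> 'n vfield \<Rightarrow> 'n::finite vfield" where
  "lie_bracket V W =
     (\<lambda>x. frechet_derivative W (at x) (V x) - frechet_derivative V (at x) (W x))"

definition bracket_span :: "'n vfield set \<Rightarrow> 'n vfield set \<Rightarrow> 'n::finite vfield set" where
  "bracket_span A B = vf.span {lie_bracket V W |V W. V \<in> A \<and> W \<in> B}"

subsection \<open>Carnot groups in exponential coordinates\<close>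

text \<open>A Lie group whose underlying manifold is \<open>\<real>\<^sup>n\<close> with its standard smooth structure;
  in particular it is connected and simply connected.\<close>

locale Rn_lie_group = group G for G :: "(real^'n::finite) monoid" (structure) +
  assumes carrier_UNIV: "carrier G = UNIV"
    and smooth_mult: "smooth (\<lambda>p::(real^'n) \<times> (real^'n). fst p \<otimes> snd p)"
    and smooth_inv: "smooth (\<lambda>x. inv x)"

definition left_invariant_fields :: "(real^'n) monoid \<Rightarrow> 'n::finite vfield set" where
  "left_invariant_fields G =
     {V. smooth V \<and>
         (\<forall>g x. frechet_derivative (\<lambda>y. g \<otimes>\<^bsub>G\<^esub> y) (at x) (V x) = V (g \<otimes>\<^bsub>G\<^esub> x))}"

text \<open>\<open>is_exp G V g\<close> says \<open>g = exp V\<close>: \<open>g\<close> is the time-one value of the integral curve of \<open>V\<close>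
  issuing from the identity.\<close>

definition is_exp :: "(real^'n) monoid \<Rightarrow> 'n vfield \<Rightarrow> real^'n::finite \<Rightarrow> bool" where
  "is_exp G V g \<longleftrightarrow>
     (\<exists>c. c 0 = \<one>\<^bsub>G\<^esub> \<and> c (1::real) = g \<and> (\<forall>t. (c has_vector_derivative V (c t)) (at t)))"

text \<open>\<open>X\<close> is the adapted basis, \<open>w j\<close> is the index of the layer containing \<open>X j\<close>, and \<open>layer i\<close> is
  the subspace \<open>\<gg>\<^sub>i\<close>; the decomposition of the Lie algebra as the direct sum of the layers is
  contained in \<open>X\<close> being a basis. The index type is not ordered, so the convention that the layers
  correspond to consecutive blocks of indices becomes the labelling \<open>w\<close>. The map \<open>h\<close> enumerates the
  basis of the first layer by the type \<open>'m\<close>, whose cardinality is therefore the rank.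
  By \<open>exponential_coordinates\<close> the identification of \<open>\<real>\<^sup>n\<close> with the group is the exponential map.\<close>

locale carnot_group = Rn_lie_group G for G :: "(real^'n::finite) monoid" (structure) +
  fixes k :: nat
    and w :: "'n \<Rightarrow> nat"
    and X :: "'n \<Rightarrow> 'n vfield"
    and h :: "'m::finite \<Rightarrow> 'n"
    and layer :: "nat \<Rightarrow> 'n vfield set"
  defines "layer \<equiv> (\<lambda>i. vf.span (X ` {j. w j = i}))"
  assumes basis_inj: "inj X"
    and basis_independent: "vf.independent (range X)"
    and basis_span: "vf.span (range X) = left_invariant_fields G"
    and layer_range: "w j \<in> {1..k}"
    and layer_step: "\<lbrakk>1 \<le> i; i < k\<rbrakk> \<Longrightarrow> bracket_span (layer 1) (layer i) = layer (Suc i)"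
    and last_layer_nonzero: "layer k \<noteq> {0}"
    and last_layer_central: "bracket_span (layer 1) (layer k) = {0}"
    and first_layer_enum: "bij_betw h UNIV {j. w j = 1}"
    and exponential_coordinates: "is_exp G (\<lambda>x. \<Sum>j\<in>UNIV. y $ j *\<^sub>R X j x) y"

subsection \<open>Horizontal curves and the Carnot-Caratheodory distance\<close>

text \<open>From here on \<open>Y\<close> is the frame of horizontal vector fields \<open>X\<^sub>1, \<dots>, X\<^sub>m\<close>.\<close>

definition abs_continuous_on_interval ::
  "real \<Rightarrow> real \<Rightarrow> (real \<Rightarrow> 'a::metric_space) \<Rightarrow> bool" where
  "abs_continuous_on_interval a b f \<longleftrightarrow>
     (\<forall>\<epsilon>>0. \<exists>\<delta>>0. \<forall>D. finite D \<and> D \<subseteq> {(s, t). a \<le> s \<and> s < t \<and> t \<le> b} \<and>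
        disjoint_family_on (\<lambda>(s, t). {s<..<t}) D \<and> (\<Sum>(s, t)\<in>D. t - s) < \<delta> \<longrightarrow>
        (\<Sum>(s, t)\<in>D. dist (f s) (f t)) < \<epsilon>)"

text \<open>The control \<open>a\<close> is the coordinate representation of the velocity; it is determined by the curve
  almost everywhere.\<close>

definition horizontal_curve ::
  "('m::finite \<Rightarrow> 'n::finite vfield) \<Rightarrow> real \<Rightarrow> (real \<Rightarrow> real^'n) \<Rightarrow> (real \<Rightarrow> real^'m) \<Rightarrow> bool" where
  "horizontal_curve Y T \<gamma> a \<longleftrightarrow>
     abs_continuous_on_interval 0 T \<gamma> \<and>
     a \<in> borel_measurable (lebesgue_on {0<..<T}) \<and>
     (\<exists>C. AE t in lebesgue_on {0<..<T}. norm (a t) \<le> C) \<and>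
     (AE t in lebesgue_on {0<..<T}.
        (\<gamma> has_vector_derivative (\<Sum>i\<in>UNIV. a t $ i *\<^sub>R Y i (\<gamma> t))) (at t))"

definition subunit_curve ::
  "('m::finite \<Rightarrow> 'n::finite vfield) \<Rightarrow> real \<Rightarrow> (real \<Rightarrow> real^'n) \<Rightarrow> (real \<Rightarrow> real^'m) \<Rightarrow> bool" where
  "subunit_curve Y T \<gamma> a \<longleftrightarrow>
     horizontal_curve Y T \<gamma> a \<and> (AE t in lebesgue_on {0<..<T}. norm (a t) \<le> 1)"

text \<open>The infima below are over nonempty sets for points of a domain, by the Chow-Rashevskii
  theorem, so the distances are real-valued.\<close>

definition cc_dist ::
  "('m::finite \<Rightarrow> 'n::finite vfield) \<Rightarrow> (real^'n) set \<Rightarrow> real^'n \<Rightarrow> real^'n \<Rightarrow> real" where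
  "cc_dist Y \<Omega> x y =
     Inf {LINT t|lebesgue_on {0<..<T}. norm (a t) |T \<gamma> a.
        T > 0 \<and> subunit_curve Y T \<gamma> a \<and> \<gamma> ` {0..T} \<subseteq> \<Omega> \<and> \<gamma> 0 = x \<and> \<gamma> T = y}"

subsection \<open>Hamiltonians, optical length and Monge solutions\<close>

definition sublevel ::
  "(real^'n \<Rightarrow> real^'m \<Rightarrow> real) \<Rightarrow> real^'n \<Rightarrow> (real^'m) set" where
  "sublevel H x = {p. H x p \<le> 0}"

definition hamiltonian_H ::
  "(real^'n::finite) set \<Rightarrow> (real^'n \<Rightarrow> real^'m::finite \<Rightarrow> real) \<Rightarrow> bool" where
  "hamiltonian_H \<Omega> H \<longleftrightarrow>
     (\<lambda>z. H (fst z) (snd z)) \<in> borel_measurable (restrict_space borel (\<Omega> \<times> UNIV)) \<and>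
     (\<forall>x\<in>\<Omega>. closed (sublevel H x) \<and> convex (sublevel H x) \<and>
        frontier (sublevel H x) = {p. H x p = 0}) \<and>
     (\<exists>\<alpha>>1. \<forall>x\<in>\<Omega>. ball 0 (1 / \<alpha>) \<subseteq> sublevel H x \<and> sublevel H x \<subseteq> ball 0 \<alpha>)"

definition sigma_star ::
  "(real^'n \<Rightarrow> real^'m \<Rightarrow> real) \<Rightarrow> real^'n \<Rightarrow> real^'m::finite \<Rightarrow> real" where
  "sigma_star H x p = (SUP \<xi>\<in>sublevel H x. (- \<xi>) \<bullet> p)"

definition optical_dist ::
  "('m::finite \<Rightarrow> 'n::finite vfield) \<Rightarrow> (real^'n) set \<Rightarrow> (real^'n \<Rightarrow> real^'m \<Rightarrow> real) \<Rightarrow>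
   real^'n \<Rightarrow> real^'n \<Rightarrow> real" where
  "optical_dist Y \<Omega> H x y =
     Inf {LINT t|lebesgue_on {0<..<1}. sigma_star H (\<gamma> t) (a t) |\<gamma> a.
        horizontal_curve Y 1 \<gamma> a \<and> \<gamma> ` {0..1} \<subseteq> \<Omega> \<and> \<gamma> 0 = x \<and> \<gamma> 1 = y}"

definition monge_quotient ::
  "('m::finite \<Rightarrow> 'n::finite vfield) \<Rightarrow> (real^'n) set \<Rightarrow> (real^'n \<Rightarrow> real^'m \<Rightarrow> real) \<Rightarrow>
   (real^'n \<Rightarrow> real) \<Rightarrow> real^'n \<Rightarrow> real^'n \<Rightarrow> real" where
  "monge_quotient Y \<Omega> H u x0 x =
     (u x - u x0 + optical_dist Y \<Omega> H x0 x) / cc_dist Y \<Omega> x0 x"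

definition monge_subsolution ::
  "('m::finite \<Rightarrow> 'n::finite vfield) \<Rightarrow> (real^'n) set \<Rightarrow> (real^'n \<Rightarrow> real^'m \<Rightarrow> real) \<Rightarrow>
   (real^'n \<Rightarrow> real) \<Rightarrow> bool" where
  "monge_subsolution Y \<Omega> H u \<longleftrightarrow> continuous_on \<Omega> u \<and>
     (\<forall>x0\<in>\<Omega>. Liminf (at x0 within \<Omega>) (\<lambda>x. ereal (monge_quotient Y \<Omega> H u x0 x)) \<ge> 0)"

definition monge_supersolution ::
  "('m::finite \<Rightarrow> 'n::finite vfield) \<Rightarrow> (real^'n) set \<Rightarrow> (real^'n \<Rightarrow> real^'m \<Rightarrow> real) \<Rightarrow>
   (real^'n \<Rightarrow> real) \<Rightarrow> bool" where
  "monge_supersolution Y \<Omega> H u \<longleftrightarrow> continuous_on \<Omega> u \<and>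
     (\<forall>x0\<in>\<Omega>. Liminf (at x0 within \<Omega>) (\<lambda>x. ereal (monge_quotient Y \<Omega> H u x0 x)) \<le> 0)"

end

theory Submission
  imports Defs
begin

text \<open>
  Suppose \<open>u > v\<close> somewhere. For \<open>\<theta> < 1\<close> close to \<open>1\<close> the function \<open>\<theta> u - v\<close> still has its maximum over the
  closure of \<open>\<Omega>\<close> at an interior point \<open>x\<close>. The Monge conditions are inequalities at single points, so
  they can be compared directly at \<open>x\<close>, and \<open>\<theta> u\<close> is a strict subsolution.
  Writing \<open>o\<close> and \<open>d\<close> for the optical and the Carnot-Caratheodory distance from \<open>x\<close> to \<open>y\<close>, maximality gives
  \<open>v y - v x + o \<ge> \<theta> (u y - u x + o) + (1 - \<theta>) o\<close>. After division by \<open>d\<close> the first summand has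
  lower limit at least \<open>0\<close>, and the second one is at least \<open>(1 - \<theta>) / \<alpha>\<close> as soon as \<open>d \<le> \<alpha> o\<close>. Hence the
  lower limit in the supersolution condition for \<open>v\<close> would be positive. This is
  \<open>Liminf_monge_quotient_pos\<close>.

  The division needs three facts about the two distances, for \<open>y \<noteq> x\<close> near \<open>x\<close>.

  The inequality \<open>d \<le> \<alpha> o\<close> (\<open>cc_dist_le_optical_dist\<close>): the sublevel sets contain a ball of radius
  \<open>1 / \<alpha>\<close>, so the optical density dominates \<open>norm p / \<alpha>\<close>, and a horizontal curve on the unit interval
  becomes sub-unit, with unchanged length, after a linear change of time. A function that is not integrable has
  integral \<open>0\<close> by convention, so the density along a curve must be shown to be measurable; it is a
  countable supremum.

  The positivity \<open>d > 0\<close> (\<open>cc_dist_pos\<close>): horizontal fields are bounded on the bounded set \<open>\<Omega>\<close>, so by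
  the fundamental theorem of calculus for absolutely continuous curves the length of a curve controls the
  Euclidean distance of its end points.

  The existence of a horizontal curve in \<open>\<Omega>\<close> from \<open>x\<close> to \<open>y\<close> (\<open>connectable_nearby\<close>), without which both
  infima are over the empty set and carry no information. This is the local Chow-Rashevskii theorem. The
  products of short pieces of one-parameter curves of the first layer form the set \<open>reach\<close>. If a covector
  \<open>\<xi>\<close> at the identity, extended to a right-invariant one-form, vanishes on the first layer at all points of this
  set, then differentiating along the flows shows that it vanishes on iterated brackets as well, hence on all
  left-invariant fields, so \<open>\<xi> = 0\<close>. Thus conjugates of first-layer directions by short elements span the
  tangent space at the identity, and a product of the corresponding conjugated curves has
  the identity as its derivative. An open mapping theorem then yields a neighbourhood of the identity
  consisting of short products.
\<close>

section \<open>Absolutely continuous curves\<close>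

lemma disjoint_intervals_length_le:
  fixes D :: "(real \<times> real) set"
  assumes "finite D" and lt: "\<And>s t. (s, t) \<in> D \<Longrightarrow> s < t"
    and dis: "disjoint_family_on (\<lambda>(s, t). {s<..<t}) D"
    and sub: "\<And>s t. (s, t) \<in> D \<Longrightarrow> {s<..<t} \<subseteq> U" and U: "U \<in> lmeasurable"
  shows "(\<Sum>(s, t)\<in>D. t - s) \<le> measure lebesgue U"
proof -
  have "(\<Sum>(s, t)\<in>D. t - s) = (\<Sum>i\<in>D. measure lebesgue ((\<lambda>(s, t). {s<..<t}) i))"
    by (rule sum.cong) (use lt in \<open>auto simp: less_imp_le\<close>)
  also have "\<dots> = measure lebesgue (\<Union>i\<in>D. (\<lambda>(s, t). {s<..<t}) i)"
    by (rule measure_UNION'[symmetric])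
      (use \<open>finite D\<close> dis in \<open>auto simp: disjoint_family_on_def pairwise_def disjnt_def\<close>)
  also have "\<dots> \<le> measure lebesgue U"
    by (rule measure_mono_fmeasurable) (use sub U \<open>finite D\<close> in \<open>auto\<close>)
  finally show ?thesis .
qed

lemma abs_continuousE:
  assumes ac: "abs_continuous_on_interval a b f" and "\<epsilon> > 0"
  obtains \<delta> where "\<delta> > 0"
    "\<And>D. \<lbrakk>finite D; D \<subseteq> {(s, t). a \<le> s \<and> s < t \<and> t \<le> b};
      disjoint_family_on (\<lambda>(s, t). {s<..<t}) D; (\<Sum>(s, t)\<in>D. t - s) < \<delta>\<rbrakk> \<Longrightarrow>
      (\<Sum>(s, t)\<in>D. dist (f s) (f t)) < \<epsilon>"
proof -
  from ac[unfolded abs_continuous_on_interval_def, rule_format, OF \<open>\<epsilon> > 0\<close>]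
  obtain \<delta> where "\<delta> > 0" and \<delta>: "\<forall>D. finite D \<and> D \<subseteq> {(s, t). a \<le> s \<and> s < t \<and> t \<le> b} \<and>
      disjoint_family_on (\<lambda>(s, t). {s<..<t}) D \<and> (\<Sum>(s, t)\<in>D. t - s) < \<delta> \<longrightarrow>
      (\<Sum>(s, t)\<in>D. dist (f s) (f t)) < \<epsilon>"
    by (elim exE conjE)
  show thesis
    by (rule that[OF \<open>\<delta> > 0\<close>], rule \<delta>[rule_format]) (intro conjI)
qed

text \<open>Absolute continuity in the form in which gauge integration uses it: the oscillation of \<open>f\<close> over the
  intervals of a tagged division that lie in a set of small measure is small. Degenerate intervals contribute
  nothing, and the remaining ones are determined by their end points because their interiors are disjoint.\<close>

lemma abs_continuous_tagged_sum_small: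
  fixes f :: "real \<Rightarrow> 'a::real_normed_vector"
  assumes ac: "abs_continuous_on_interval a b f" and "\<epsilon> > 0"
  obtains \<delta> where "\<delta> > 0"
    "\<And>U p. \<lbrakk>U \<in> lmeasurable; measure lebesgue U < \<delta>; p tagged_partial_division_of {a..b};
       \<Union> (snd ` p) \<subseteq> U\<rbrakk> \<Longrightarrow> (\<Sum>(x, K)\<in>p. norm (f (Sup K) - f (Inf K))) < \<epsilon>"
proof -
  obtain \<delta> where "\<delta> > 0"
    and \<delta>: "\<And>D. \<lbrakk>finite D; D \<subseteq> {(s, t). a \<le> s \<and> s < t \<and> t \<le> b};
        disjoint_family_on (\<lambda>(s, t). {s<..<t}) D; (\<Sum>(s, t)\<in>D. t - s) < \<delta>\<rbrakk> \<Longrightarrow>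
        (\<Sum>(s, t)\<in>D. dist (f s) (f t)) < \<epsilon>"
    using that by (rule abs_continuousE[OF ac \<open>\<epsilon> > 0\<close>])
  show thesis
  proof (rule that[OF \<open>\<delta> > 0\<close>])
    fix U p assume U: "U \<in> lmeasurable" "measure lebesgue U < \<delta>"
      and p: "p tagged_partial_division_of {a..b}" and pU: "\<Union> (snd ` p) \<subseteq> U"
    let ?\<phi> = "\<lambda>(x::real, K::real set). (Inf K, Sup K)"
    define q where "q = {z \<in> p. Inf (snd z) < Sup (snd z)}"
    have fin: "finite p" "finite q" using p by (auto simp: tagged_partial_division_of_def q_def)
    have K: "\<exists>c d. K = {c..d} \<and> c \<le> d" if z: "(x, K) \<in> p" for x K
    proof -
      have "x \<in> K" using tagged_partial_division_ofD(2)[OF p z] .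
      moreover obtain c d where "K = cbox c d" using tagged_partial_division_ofD(4)[OF p z] by blast
      ultimately show ?thesis by (auto intro!: exI[of _ c] exI[of _ d])
    qed
    have qK: "K = {Inf K..Sup K} \<and> a \<le> Inf K \<and> Sup K \<le> b \<and> Inf K < Sup K" if z: "(x, K) \<in> q" for x K
    proof -
      have z': "(x, K) \<in> p" "Inf K < Sup K" using z by (auto simp: q_def)
      obtain c d where cd: "K = {c..d}" "c \<le> d" using K[OF z'(1)] by blast
      moreover have "K \<subseteq> {a..b}" using tagged_partial_division_ofD(3)[OF p z'(1)] .
      ultimately show ?thesis using z' by auto
    qed
    have inter: "interior K \<inter> interior K' = {}" if "(x, K) \<in> q" "(x', K') \<in> q" "(x, K) \<noteq> (x', K')" for x K x' K'
      by (rule tagged_partial_division_ofD(5)[OF p]) (use that in \<open>auto simp: q_def\<close>)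
    have intK: "interior K = {Inf K<..<Sup K}" "interior K \<noteq> {}" if "(x, K) \<in> q" for x K
    proof -
      show *: "interior K = {Inf K<..<Sup K}" using qK[OF that] by (metis interior_atLeastAtMost_real)
      show "interior K \<noteq> {}" using qK[OF that] unfolding * by auto
    qed
    have inj: "inj_on ?\<phi> q"
    proof (rule inj_onI, clarify)
      fix x K x' K' assume z: "(x, K) \<in> q" "(x', K') \<in> q" "Inf K = Inf K'" "Sup K = Sup K'"
      then have "K = K'" using qK[OF z(1)] qK[OF z(2)] by metis
      then show "x = x' \<and> K = K'" using inter[OF z(1,2)] intK[OF z(1)] by auto
    qed
    have "(\<Sum>(x, K)\<in>p. norm (f (Sup K) - f (Inf K))) = (\<Sum>(x, K)\<in>q. norm (f (Sup K) - f (Inf K)))"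
    proof (rule sum.mono_neutral_right[OF fin(1)])
      show "q \<subseteq> p" by (auto simp: q_def)
      show "\<forall>i\<in>p - q. (case i of (x, K) \<Rightarrow> norm (f (Sup K) - f (Inf K))) = 0"
      proof clarify
        fix x K assume "(x, K) \<in> p" "(x, K) \<notin> q"
        then obtain c d where "K = {c..d}" "c \<le> d" "\<not> Inf K < Sup K" using K by (force simp: q_def)
        then show "norm (f (Sup K) - f (Inf K)) = 0" by auto
      qed
    qed
    also have "\<dots> = (\<Sum>(s, t)\<in>?\<phi> ` q. dist (f s) (f t))"
      by (subst sum.reindex[OF inj]) (auto intro!: sum.cong simp: dist_norm norm_minus_commute)
    also have "\<dots> < \<epsilon>"
    proof (rule \<delta>)
      show "finite (?\<phi> ` q)" using fin by simp
      show "?\<phi> ` q \<subseteq> {(s, t). a \<le> s \<and> s < t \<and> t \<le> b}" using qK by fastforce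
      show dis: "disjoint_family_on (\<lambda>(s, t). {s<..<t}) (?\<phi> ` q)"
      proof (unfold disjoint_family_on_def, intro ballI impI)
        fix i j assume ij: "i \<in> ?\<phi> ` q" "j \<in> ?\<phi> ` q" "i \<noteq> j"
        then obtain x K x' K' where z: "(x, K) \<in> q" "(x', K') \<in> q" "(x, K) \<noteq> (x', K')"
          and ij_eq: "i = (Inf K, Sup K)" "j = (Inf K', Sup K')" by auto
        from inter[OF z] show "(\<lambda>(s, t). {s<..<t}) i \<inter> (\<lambda>(s, t). {s<..<t}) j = {}"
          unfolding ij_eq using intK(1)[OF z(1)] intK(1)[OF z(2)] by simp
      qed
      have "(\<Sum>(s, t)\<in>?\<phi> ` q. t - s) \<le> measure lebesgue U"
      proof (rule disjoint_intervals_length_le[OF _ _ dis _ U(1)])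
        fix s t assume "(s, t) \<in> ?\<phi> ` q"
        then obtain x K where z: "(x, K) \<in> q" "s = Inf K" "t = Sup K" by auto
        then show "s < t" using qK by blast
        have "K \<subseteq> U" using z pU by (force simp: q_def)
        then show "{s<..<t} \<subseteq> U" using intK(1)[OF z(1)] interior_subset[of K] z by auto
      qed (use fin in auto)
      then show "(\<Sum>(s, t)\<in>?\<phi> ` q. t - s) < \<delta>" using U by simp
    qed
    finally show "(\<Sum>(x, K)\<in>p. norm (f (Sup K) - f (Inf K))) < \<epsilon>" .
  qed
qed

text \<open>The fundamental theorem of calculus with an exceptional null set \<open>N\<close>. Outside \<open>N\<close> the gauge makes the
  linear approximation by the derivative accurate. On \<open>N\<close> the gauge is an open set \<open>U\<close> of small measure around \<open>N\<close>,
  and absolute continuity bounds the increments of \<open>f\<close> over all intervals tagged in \<open>N\<close>.\<close>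

theorem abs_continuous_has_integral_deriv:
  fixes f :: "real \<Rightarrow> 'a::banach"
  assumes "a \<le> b" and ac: "abs_continuous_on_interval a b f" and N: "negligible N"
    and der: "\<And>t. t \<in> {a..b} - N \<Longrightarrow> (f has_vector_derivative f' t) (at t)"
  shows "(f' has_integral (f b - f a)) {a..b}"
proof -
  define g where "g t = (if t \<in> N then 0 else f' t)" for t
  have "(g has_integral (f b - f a)) {a..b}"
    unfolding has_integral_real
  proof (intro allI impI)
    fix e :: real assume "e > 0"
    obtain \<delta> where "\<delta> > 0" and \<delta>:
      "\<And>U p. \<lbrakk>U \<in> lmeasurable; measure lebesgue U < \<delta>; p tagged_partial_division_of {a..b};
         \<Union> (snd ` p) \<subseteq> U\<rbrakk> \<Longrightarrow> (\<Sum>(x, K)\<in>p. norm (f (Sup K) - f (Inf K))) < e / 2"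
      using that by (rule abs_continuous_tagged_sum_small[OF ac half_gt_zero[OF \<open>e > 0\<close>]])
    have "N \<in> sets lebesgue" "emeasure lebesgue N = 0"
      using N by (auto simp: negligible_iff_null_sets)
    then obtain U where U: "open U" "N \<subseteq> U" "U - N \<in> lmeasurable" "emeasure lebesgue (U - N) < ennreal \<delta>"
      using sets_lebesgue_outer_open[OF _ \<open>\<delta> > 0\<close>] by metis
    have UN: "U = (U - N) \<union> N" using U by auto
    have "N \<in> lmeasurable" using N by (simp add: negligible_imp_measurable)
    then have Um: "U \<in> lmeasurable" using U(3) UN fmeasurable.Un by metis
    have "emeasure lebesgue U \<le> emeasure lebesgue (U - N) + emeasure lebesgue N"
      by (metis U(3) UN \<open>N \<in> lmeasurable\<close> emeasure_subadditive fmeasurableD)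
    then have "emeasure lebesgue U < ennreal \<delta>"
      using U(4) \<open>emeasure lebesgue N = 0\<close> by simp
    then have Ud: "measure lebesgue U < \<delta>"
      using Um \<open>\<delta> > 0\<close> by (simp add: emeasure_eq_measure2 ennreal_less_iff)
    \<comment> \<open>the two kinds of tags may each contribute an error of \<open>e / 2\<close>; the summand \<open>1\<close> covers \<open>a = b\<close>\<close>
    define \<eta> where "\<eta> = e / (2 * (b - a + 1))"
    have "\<eta> > 0" using \<open>e > 0\<close> \<open>a \<le> b\<close> by (simp add: \<eta>_def)
    have "\<exists>d>0. \<forall>y. \<bar>y - x\<bar> < d \<longrightarrow> norm (f y - f x - (y - x) *\<^sub>R f' x) \<le> \<eta> * \<bar>y - x\<bar>"
      if "x \<in> {a..b} - N" for x
      using der[OF that] \<open>\<eta> > 0\<close> unfolding has_vector_derivative_def has_derivative_at_alt by auto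
    then obtain d where d: "\<And>x. x \<in> {a..b} - N \<Longrightarrow> d x > 0"
      "\<And>x y. x \<in> {a..b} - N \<Longrightarrow> \<bar>y - x\<bar> < d x \<Longrightarrow> norm (f y - f x - (y - x) *\<^sub>R f' x) \<le> \<eta> * \<bar>y - x\<bar>"
      by metis
    define \<gamma> where "\<gamma> x = (if x \<in> N then U else if x \<in> {a..b} then ball x (d x) else UNIV)" for x
    have gauge: "gauge \<gamma>"
      unfolding gauge_def \<gamma>_def using U d(1) by auto
    have riemann: "norm ((\<Sum>(x, K)\<in>p. measure lborel K *\<^sub>R g x) - (f b - f a)) < e"
      if p: "p tagged_division_of {a..b}" and fine: "\<gamma> fine p" for p
    proof -
      have fin: "finite p" using p by blast
      let ?N = "{z \<in> p. fst z \<in> N}" and ?R = "{z \<in> p. fst z \<notin> N}"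
      let ?h = "\<lambda>(x, K). measure lborel K *\<^sub>R g x - (f (Sup K) - f (Inf K))"
      have Kc: "\<exists>c d. K = {c..d} \<and> c \<le> d \<and> x \<in> {c..d} \<and> x \<in> {a..b}" if z: "(x, K) \<in> p" for x K
      proof -
        have "x \<in> K" "K \<subseteq> {a..b}" using tagged_division_ofD(2,3)[OF p z] by auto
        moreover obtain c d where "K = cbox c d" using tagged_division_ofD(4)[OF p z] by blast
        ultimately show ?thesis by (auto intro!: exI[of _ c] exI[of _ d])
      qed
      have "(\<Sum>(x, K)\<in>p. measure lborel K *\<^sub>R g x) - (f b - f a) = (\<Sum>z\<in>p. ?h z)"
        using additive_tagged_division_1[OF \<open>a \<le> b\<close> p, of f]
        by (simp add: sum_subtractf case_prod_unfold)
      also have "\<dots> = (\<Sum>z\<in>?N. ?h z) + (\<Sum>z\<in>?R. ?h z)"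
        by (subst sum.union_disjoint[symmetric]) (use fin in \<open>auto intro!: sum.cong\<close>)
      finally have split: "(\<Sum>(x, K)\<in>p. measure lborel K *\<^sub>R g x) - (f b - f a) = (\<Sum>z\<in>?N. ?h z) + (\<Sum>z\<in>?R. ?h z)" .
      have "norm (\<Sum>z\<in>?N. ?h z) \<le> (\<Sum>(x, K)\<in>?N. norm (f (Sup K) - f (Inf K)))"
        by (rule sum_norm_le) (auto simp: g_def norm_minus_commute)
      also have "\<dots> < e / 2"
      proof (rule \<delta>[OF Um Ud])
        show "?N tagged_partial_division_of {a..b}"
          by (rule tagged_partial_division_subset[of p]) (use p in \<open>auto simp: tagged_division_of_def\<close>)
        show "\<Union> (snd ` ?N) \<subseteq> U"
          using fine by (fastforce simp: fine_def \<gamma>_def)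
      qed
      finally have nN: "norm (\<Sum>z\<in>?N. ?h z) < e / 2" .
      have "norm (\<Sum>z\<in>?R. ?h z) \<le> (\<Sum>(x, K)\<in>?R. \<eta> * (Sup K - Inf K))"
      proof (rule sum_norm_le, clarify)
        fix x K assume xK: "(x, K) \<in> p" "fst (x, K) \<notin> N"
        then obtain c k where ck: "K = {c..k}" "c \<le> k" "x \<in> {c..k}" and xab: "x \<in> {a..b} - N"
          using Kc[OF xK(1)] by auto
        have "K \<subseteq> \<gamma> x" using fineD[OF fine xK(1)] .
        then have "K \<subseteq> ball x (d x)" using xab by (simp add: \<gamma>_def)
        moreover have "c \<in> K" "k \<in> K" using ck by auto
        ultimately have "dist x c < d x" "dist x k < d x" by auto
        then have ck': "\<bar>c - x\<bar> < d x" "\<bar>k - x\<bar> < d x" by (simp_all add: dist_real_def abs_minus_commute)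
        have "measure lborel K *\<^sub>R g x - (f (Sup K) - f (Inf K))
            = (f c - f x - (c - x) *\<^sub>R f' x) - (f k - f x - (k - x) *\<^sub>R f' x)"
          using ck xab by (simp add: g_def algebra_simps)
        then have "norm (measure lborel K *\<^sub>R g x - (f (Sup K) - f (Inf K))) \<le> \<eta> * \<bar>c - x\<bar> + \<eta> * \<bar>k - x\<bar>"
          using d(2)[OF xab ck'(1)] d(2)[OF xab ck'(2)] norm_triangle_ineq4 by (smt (verit))
        also have "\<dots> = \<eta> * (Sup K - Inf K)" using ck by (simp add: algebra_simps)
        finally show "norm (measure lborel K *\<^sub>R g x - (f (Sup K) - f (Inf K))) \<le> \<eta> * (Sup K - Inf K)" .
      qed
      also have "\<dots> \<le> (\<Sum>(x, K)\<in>p. \<eta> * (Sup K - Inf K))"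
        by (rule sum_mono2[OF fin]) (use Kc \<open>\<eta> > 0\<close> in fastforce)+
      also have "\<dots> = \<eta> * (b - a)"
        using additive_tagged_division_1[OF \<open>a \<le> b\<close> p, of id]
        by (simp add: sum_distrib_left[symmetric] case_prod_unfold)
      also have "\<dots> \<le> e / 2" using \<open>a \<le> b\<close> \<open>e > 0\<close> by (simp add: \<eta>_def field_simps)
      finally show ?thesis unfolding split using nN norm_triangle_ineq
        by (smt (verit) field_sum_of_halves)
    qed
    show "\<exists>\<gamma>. gauge \<gamma> \<and> (\<forall>\<D>. \<D> tagged_division_of {a..b} \<and> \<gamma> fine \<D> \<longrightarrow>
        norm ((\<Sum>(x, K)\<in>\<D>. measure lborel K *\<^sub>R g x) - (f b - f a)) < e)"
      by (intro exI[of _ \<gamma>] conjI allI impI gauge) (elim conjE, rule riemann)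
  qed
  then show ?thesis
    by (rule has_integral_spike[OF N, rotated]) (auto simp: g_def)
qed

lemma lipschitz_imp_abs_continuous:
  assumes "L-lipschitz_on {a..b} f"
  shows "abs_continuous_on_interval a b f"
  unfolding abs_continuous_on_interval_def
proof (intro allI impI)
  fix e :: real assume "e > 0"
  have L: "L \<ge> 0" using assms lipschitz_on_nonneg by blast
  show "\<exists>\<delta>>0. \<forall>D. finite D \<and> D \<subseteq> {(s, t). a \<le> s \<and> s < t \<and> t \<le> b} \<and>
      disjoint_family_on (\<lambda>(s, t). {s<..<t}) D \<and> (\<Sum>(s, t)\<in>D. t - s) < \<delta> \<longrightarrow>
      (\<Sum>(s, t)\<in>D. dist (f s) (f t)) < e"
  proof (intro exI[of _ "e / (L + 1)"] conjI allI impI; (elim conjE)?)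
    show "e / (L + 1) > 0" using \<open>e > 0\<close> L by simp
    fix D assume D: "D \<subseteq> {(s, t). a \<le> s \<and> s < t \<and> t \<le> b}" "(\<Sum>(s, t)\<in>D. t - s) < e / (L + 1)"
    have pos: "(\<Sum>(s, t)\<in>D. t - s) \<ge> 0" by (rule sum_nonneg) (use D in auto)
    have "(\<Sum>(s, t)\<in>D. dist (f s) (f t)) \<le> (\<Sum>(s, t)\<in>D. L * (t - s))"
    proof (rule sum_mono, clarify)
      fix s t assume "(s, t) \<in> D"
      then have "s \<in> {a..b}" "t \<in> {a..b}" "s < t" using D by auto
      then show "dist (f s) (f t) \<le> L * (t - s)" using lipschitz_onD[OF assms, of s t] by (simp add: dist_real_def)
    qed
    also have "\<dots> = L * (\<Sum>(s, t)\<in>D. t - s)" by (simp add: sum_distrib_left case_prod_unfold)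
    also have "\<dots> \<le> (L + 1) * (\<Sum>(s, t)\<in>D. t - s)" using pos by (simp add: algebra_simps)
    also have "\<dots> < e" using D(2) L by (simp add: field_simps)
    finally show "(\<Sum>(s, t)\<in>D. dist (f s) (f t)) < e" .
  qed
qed

lemma abs_continuous_rescale:
  assumes ac: "abs_continuous_on_interval 0 T f" and "c > 0"
  shows "abs_continuous_on_interval 0 (T / c) (\<lambda>t. f (c * t))"
  unfolding abs_continuous_on_interval_def
proof (intro allI impI)
  fix e :: real assume "e > 0"
  obtain \<delta> where "\<delta> > 0"
    and \<delta>: "\<And>D. \<lbrakk>finite D; D \<subseteq> {(s, t). 0 \<le> s \<and> s < t \<and> t \<le> T};
        disjoint_family_on (\<lambda>(s, t). {s<..<t}) D; (\<Sum>(s, t)\<in>D. t - s) < \<delta>\<rbrakk> \<Longrightarrow>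
        (\<Sum>(s, t)\<in>D. dist (f s) (f t)) < e"
    using that by (rule abs_continuousE[OF ac \<open>e > 0\<close>])
  show "\<exists>\<delta>>0. \<forall>D. finite D \<and> D \<subseteq> {(s, t). 0 \<le> s \<and> s < t \<and> t \<le> T / c} \<and>
      disjoint_family_on (\<lambda>(s, t). {s<..<t}) D \<and> (\<Sum>(s, t)\<in>D. t - s) < \<delta> \<longrightarrow>
      (\<Sum>(s, t)\<in>D. dist (f (c * s)) (f (c * t))) < e"
  proof (intro exI[of _ "\<delta> / c"] conjI allI impI; (elim conjE)?)
    show "\<delta> / c > 0" using \<open>\<delta> > 0\<close> \<open>c > 0\<close> by simp
    fix D assume D: "finite D" "D \<subseteq> {(s, t). 0 \<le> s \<and> s < t \<and> t \<le> T / c}"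
      "disjoint_family_on (\<lambda>(s, t). {s<..<t}) D" "(\<Sum>(s, t)\<in>D. t - s) < \<delta> / c"
    let ?\<phi> = "\<lambda>(s, t). (c * s, c * t)"
    have inj: "inj_on ?\<phi> D" using \<open>c > 0\<close> by (auto simp: inj_on_def)
    have "(\<Sum>(s, t)\<in>?\<phi> ` D. dist (f s) (f t)) < e"
    proof (rule \<delta>)
      show "finite (?\<phi> ` D)" using D by simp
      show "?\<phi> ` D \<subseteq> {(s, t). 0 \<le> s \<and> s < t \<and> t \<le> T}" using D \<open>c > 0\<close> by (auto simp: field_simps)
      show "disjoint_family_on (\<lambda>(s, t). {s<..<t}) (?\<phi> ` D)"
      proof (unfold disjoint_family_on_def, intro ballI impI)
        fix i j assume ij: "i \<in> ?\<phi> ` D" "j \<in> ?\<phi> ` D" "i \<noteq> j"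
        then obtain s t s' t' where z: "(s, t) \<in> D" "(s', t') \<in> D" "(s, t) \<noteq> (s', t')"
          and ij_eq: "i = (c * s, c * t)" "j = (c * s', c * t')" by auto
        have "{s<..<t} \<inter> {s'<..<t'} = {}" using D(3)[unfolded disjoint_family_on_def, rule_format, OF z] by simp
        moreover have "x / c \<in> {s<..<t} \<inter> {s'<..<t'}" if "x \<in> {c * s<..<c * t} \<inter> {c * s'<..<c * t'}" for x
          using that \<open>c > 0\<close> by (auto simp: field_simps)
        ultimately show "(\<lambda>(s, t). {s<..<t}) i \<inter> (\<lambda>(s, t). {s<..<t}) j = {}" unfolding ij_eq by blast
      qed
      have "(\<Sum>(s, t)\<in>?\<phi> ` D. t - s) = c * (\<Sum>(s, t)\<in>D. t - s)"
        by (subst sum.reindex[OF inj]) (auto simp: sum_distrib_left right_diff_distrib intro!: sum.cong)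
      then show "(\<Sum>(s, t)\<in>?\<phi> ` D. t - s) < \<delta>" using D(4) \<open>c > 0\<close> by (simp add: field_simps)
    qed
    then show "(\<Sum>(s, t)\<in>D. dist (f (c * s)) (f (c * t))) < e"
      by (subst (asm) sum.reindex[OF inj]) (auto simp: case_prod_unfold)
  qed
qed

section \<open>Horizontal curves and their length\<close>

lemma AE_lebesgue_on_negligible:
  assumes "S \<in> sets lebesgue"
  shows "(AE t in lebesgue_on S. P t) \<longleftrightarrow> (\<exists>N. negligible N \<and> (\<forall>t\<in>S - N. P t))"
proof -
  have "(AE t in lebesgue_on S. P t) \<longleftrightarrow> (AE t in lebesgue. t \<in> S \<longrightarrow> P t)"
    by (rule AE_restrict_space_iff) (use assms in auto)
  also have "\<dots> \<longleftrightarrow> (\<exists>N. negligible N \<and> (\<forall>t\<in>S - N. P t))"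
    unfolding eventually_ae_filter_negligible by blast
  finally show ?thesis .
qed

lemma horizontal_curveE:
  assumes "horizontal_curve Y T \<gamma> a"
  obtains N where "negligible N" "\<And>t. t \<in> {0<..<T} - N \<Longrightarrow>
    (\<gamma> has_vector_derivative (\<Sum>i\<in>UNIV. a t $ i *\<^sub>R Y i (\<gamma> t))) (at t)"
proof -
  from assms have "AE t in lebesgue_on {0<..<T}.
      (\<gamma> has_vector_derivative (\<Sum>i\<in>UNIV. a t $ i *\<^sub>R Y i (\<gamma> t))) (at t)"
    unfolding horizontal_curve_def by blast
  then obtain N where N: "negligible N" "\<forall>t\<in>{0<..<T} - N.
      (\<gamma> has_vector_derivative (\<Sum>i\<in>UNIV. a t $ i *\<^sub>R Y i (\<gamma> t))) (at t)"
    by (subst (asm) AE_lebesgue_on_negligible) auto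
  show thesis by (rule that[OF N(1)]) (use N(2) in auto)
qed

lemma abs_continuous_imp_continuous_on:
  assumes "abs_continuous_on_interval a b f"
  shows "continuous_on {a..b} f"
  unfolding continuous_on_iff
proof (intro ballI allI impI)
  fix x e :: real assume x: "x \<in> {a..b}" and "e > 0"
  obtain \<delta> where "\<delta> > 0"
    and \<delta>: "\<And>D. \<lbrakk>finite D; D \<subseteq> {(s, t). a \<le> s \<and> s < t \<and> t \<le> b};
      disjoint_family_on (\<lambda>(s, t). {s<..<t}) D; (\<Sum>(s, t)\<in>D. t - s) < \<delta>\<rbrakk> \<Longrightarrow>
      (\<Sum>(s, t)\<in>D. dist (f s) (f t)) < e"
    using that by (rule abs_continuousE[OF assms \<open>e > 0\<close>])
  have *: "dist (f s) (f t) < e" if "a \<le> s" "s < t" "t \<le> b" "t - s < \<delta>" for s t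
    using \<delta>[of "{(s, t)}"] that by (simp add: disjoint_family_on_def)
  show "\<exists>d>0. \<forall>y\<in>{a..b}. dist y x < d \<longrightarrow> dist (f y) (f x) < e"
  proof (intro exI[of _ \<delta>] conjI ballI impI)
    fix y assume y: "y \<in> {a..b}" "dist y x < \<delta>"
    consider "y < x" | "y = x" | "x < y" by linarith
    then show "dist (f y) (f x) < e"
    proof cases
      case 1 then show ?thesis using *[of y x] x y by (simp add: dist_real_def)
    next
      case 2 then show ?thesis using \<open>e > 0\<close> by simp
    next
      case 3 then show ?thesis using *[of x y] x y by (simp add: dist_real_def dist_commute)
    qed
  qed fact
qed

lemma AE_lebesgue_on_rescale:
  fixes T c :: real
  assumes "c > 0" and P: "AE t in lebesgue_on {0<..<T}. P t"
  shows "AE t in lebesgue_on {0<..<T / c}. P (c * t)"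
proof -
  from P obtain N where N: "negligible N" "\<forall>t\<in>{0<..<T} - N. P t"
    by (subst (asm) AE_lebesgue_on_negligible) auto
  have "negligible ((\<lambda>t. t / c) ` N)"
    by (rule negligible_differentiable_image_negligible[OF order_refl N(1)])
      (auto simp: differentiable_on_def divide_inverse)
  moreover have "P (c * t)" if "t \<in> {0<..<T / c} - (\<lambda>t. t / c) ` N" for t
  proof -
    have "c * t \<notin> N" using that \<open>c > 0\<close> by (auto simp: image_iff)
    then show ?thesis using N(2) that \<open>c > 0\<close> by (auto simp: field_simps)
  qed
  ultimately show ?thesis by (subst AE_lebesgue_on_negligible) auto
qed

lemma borel_measurable_lebesgue_on_rescale:
  fixes a :: "real \<Rightarrow> 'b::euclidean_space"
  assumes "c > 0" and a: "a \<in> borel_measurable (lebesgue_on {0<..<T})"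
  shows "(\<lambda>t. a (c * t)) \<in> borel_measurable (lebesgue_on {0<..<T / c})"
proof -
  have "(\<lambda>t. if t \<in> {0<..<T} then a t else 0) \<in> borel_measurable lebesgue"
    using a by (subst borel_measurable_if) auto
  then have "(\<lambda>t. if t \<in> {0<..<T} then a t else 0) \<circ> ((*\<^sub>R) c) \<in> borel_measurable lebesgue"
    using lebesgue_measurable_scaling by (rule measurable_comp[rotated])
  also have "(\<lambda>t. if t \<in> {0<..<T} then a t else 0) \<circ> ((*\<^sub>R) c) =
      (\<lambda>t. if t \<in> {0<..<T / c} then a (c * t) else 0)"
    using \<open>c > 0\<close> by (auto simp: fun_eq_iff field_simps zero_less_mult_iff)
  finally show ?thesis by (subst (asm) borel_measurable_if) auto
qed

text \<open>Linear changes of time let curves on the unit interval be traded for sub-unit curves on longer intervals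
  and conversely.\<close>

lemma horizontal_curve_rescale:
  assumes \<gamma>: "horizontal_curve Y T \<gamma> a" and "c > 0"
  shows "horizontal_curve Y (T / c) (\<lambda>t. \<gamma> (c * t)) (\<lambda>t. c *\<^sub>R a (c * t))"
  unfolding horizontal_curve_def
proof (intro conjI)
  show "abs_continuous_on_interval 0 (T / c) (\<lambda>t. \<gamma> (c * t))"
    using \<gamma> \<open>c > 0\<close> by (auto simp: horizontal_curve_def intro: abs_continuous_rescale)
  show "(\<lambda>t. c *\<^sub>R a (c * t)) \<in> borel_measurable (lebesgue_on {0<..<T / c})"
    using borel_measurable_lebesgue_on_rescale[OF \<open>c > 0\<close>, of a T] \<gamma>
    by (auto simp: horizontal_curve_def)
  from \<gamma> obtain C where "AE t in lebesgue_on {0<..<T}. norm (a t) \<le> C"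
    unfolding horizontal_curve_def by blast
  from AE_lebesgue_on_rescale[OF \<open>c > 0\<close> this]
  have "AE t in lebesgue_on {0<..<T / c}. norm (c *\<^sub>R a (c * t)) \<le> c * C"
    by eventually_elim (use \<open>c > 0\<close> in simp)
  then show "\<exists>C. AE t in lebesgue_on {0<..<T / c}. norm (c *\<^sub>R a (c * t)) \<le> C" by blast
  from \<gamma> have "AE t in lebesgue_on {0<..<T}.
      (\<gamma> has_vector_derivative (\<Sum>i\<in>UNIV. a t $ i *\<^sub>R Y i (\<gamma> t))) (at t)"
    unfolding horizontal_curve_def by blast
  from AE_lebesgue_on_rescale[OF \<open>c > 0\<close> this]
  show "AE t in lebesgue_on {0<..<T / c}. ((\<lambda>t. \<gamma> (c * t)) has_vector_derivative
      (\<Sum>i\<in>UNIV. (c *\<^sub>R a (c * t)) $ i *\<^sub>R Y i (\<gamma> (c * t)))) (at t)"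
  proof eventually_elim
    case (elim t)
    have "((*) c has_vector_derivative c) (at t)"
      by (auto intro!: derivative_eq_intros simp: has_real_derivative_iff_has_vector_derivative[symmetric])
    from vector_diff_chain_at[OF this elim]
    show ?case by (simp add: o_def scaleR_sum_right)
  qed
qed

lemma integrable_bounded_Ioo:
  fixes f :: "real \<Rightarrow> 'b::euclidean_space"
  assumes "f \<in> borel_measurable (lebesgue_on {0<..<T})"
    and "AE t in lebesgue_on {0<..<T}. norm (f t) \<le> C"
  shows "integrable (lebesgue_on {0<..<T}) f"
proof -
  interpret finite_measure "lebesgue_on {0<..<T}" by (rule finite_measure_lebesgue_on) simp
  show ?thesis using assms by (intro integrable_const_bound[of _ C])
qed

lemma horizontal_curve_control_integrable:
  assumes "horizontal_curve Y T \<gamma> a"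
  shows "integrable (lebesgue_on {0<..<T}) (\<lambda>t. norm (a t))"
proof -
  from assms obtain C where "AE t in lebesgue_on {0<..<T}. norm (a t) \<le> C"
    and [measurable]: "a \<in> borel_measurable (lebesgue_on {0<..<T})"
    unfolding horizontal_curve_def by blast
  then show ?thesis by (intro integrable_bounded_Ioo[of _ _ C]) auto
qed

lemma has_integral_LINT_Ioo:
  fixes f :: "real \<Rightarrow> real"
  assumes "integrable (lebesgue_on {0<..<T}) f"
  shows "(f has_integral (LINT t|lebesgue_on {0<..<T}. f t)) {0..T}"
  using has_integral_integral_lebesgue_on[OF assms] by (simp add: has_integral_Icc_iff_Ioo)

lemma length_rescale:
  assumes \<gamma>: "horizontal_curve Y T \<gamma> a" and "c > 0"
  shows "(LINT t|lebesgue_on {0<..<T / c}. norm (c *\<^sub>R a (c * t))) =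
    (LINT t|lebesgue_on {0<..<T}. norm (a t))"
proof -
  let ?I = "LINT t|lebesgue_on {0<..<T}. norm (a t)"
  have "((\<lambda>t. norm (a (c * t))) has_integral (1 / \<bar>c\<bar>) *\<^sub>R ?I) ((\<lambda>x. x / c) ` {0..T})"
    using has_integral_LINT_Ioo[OF horizontal_curve_control_integrable[OF \<gamma>]] \<open>c > 0\<close>
    by (intro has_integral_stretch_real) auto
  also have "(\<lambda>x. x / c) ` {0..T} = {0..T / c}"
    using \<open>c > 0\<close> by (simp add: image_divide_atLeastAtMost)
  finally have "((\<lambda>t. c * norm (a (c * t))) has_integral c * ((1 / \<bar>c\<bar>) *\<^sub>R ?I)) {0..T / c}"
    by (rule has_integral_mult_right)
  moreover have "((\<lambda>t. norm (c *\<^sub>R a (c * t))) has_integral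
      (LINT t|lebesgue_on {0<..<T / c}. norm (c *\<^sub>R a (c * t)))) {0..T / c}"
    by (rule has_integral_LINT_Ioo[OF horizontal_curve_control_integrable[OF horizontal_curve_rescale[OF \<gamma> \<open>c > 0\<close>]]])
  ultimately show ?thesis using \<open>c > 0\<close> by (auto dest: has_integral_unique)
qed

lemma horizontal_speed_bound:
  fixes Y :: "'m::finite \<Rightarrow> 'n::finite vfield"
  assumes "\<And>i x. x \<in> S \<Longrightarrow> norm (Y i x) \<le> B i" and "x \<in> S"
  shows "norm (\<Sum>i\<in>UNIV. p $ i *\<^sub>R Y i x) \<le> (\<Sum>i\<in>UNIV. B i) * norm p"
proof -
  have "norm (\<Sum>i\<in>UNIV. p $ i *\<^sub>R Y i x) \<le> (\<Sum>i\<in>UNIV. norm p * B i)"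
    by (rule sum_norm_le)
      (use assms in \<open>auto intro!: mult_mono simp: component_le_norm_cart\<close>)
  then show ?thesis by (simp add: sum_distrib_left mult.commute)
qed

text \<open>The bound is by the length, not by the duration, since a sub-unit curve may be arbitrarily slow and the
  Carnot-Caratheodory distance is an infimum of lengths.\<close>

lemma horizontal_displacement_le_length:
  fixes Y :: "'m::finite \<Rightarrow> 'n::finite vfield"
  assumes \<gamma>: "horizontal_curve Y T \<gamma> a" and "T > 0" and im: "\<gamma> ` {0..T} \<subseteq> S"
    and B: "\<And>i x. x \<in> S \<Longrightarrow> norm (Y i x) \<le> B i"
  shows "norm (\<gamma> T - \<gamma> 0) \<le> (\<Sum>i\<in>UNIV. B i) * (LINT t|lebesgue_on {0<..<T}. norm (a t))"
proof -
  obtain N where N: "negligible N" and der: "\<And>t. t \<in> {0<..<T} - N \<Longrightarrow>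
      (\<gamma> has_vector_derivative (\<Sum>i\<in>UNIV. a t $ i *\<^sub>R Y i (\<gamma> t))) (at t)"
    using that by (rule horizontal_curveE[OF \<gamma>])
  let ?g = "\<lambda>t. \<Sum>i\<in>UNIV. a t $ i *\<^sub>R Y i (\<gamma> t)"
  have "(?g has_integral (\<gamma> T - \<gamma> 0)) {0..T}"
  proof (rule abs_continuous_has_integral_deriv[where N = "N \<union> {0, T}"])
    show "abs_continuous_on_interval 0 T \<gamma>" using \<gamma> by (simp add: horizontal_curve_def)
    show "negligible (N \<union> {0, T})" using N by (simp add: negligible_Un)
  qed (use der \<open>T > 0\<close> in auto)
  moreover have "((\<lambda>t. (\<Sum>i\<in>UNIV. B i) * norm (a t)) has_integral
      (\<Sum>i\<in>UNIV. B i) * (LINT t|lebesgue_on {0<..<T}. norm (a t))) {0..T}"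
    by (intro has_integral_mult_right has_integral_LINT_Ioo horizontal_curve_control_integrable[OF \<gamma>])
  moreover have "\<And>t. t \<in> {0..T} \<Longrightarrow> norm (?g t) \<le> (\<Sum>i\<in>UNIV. B i) * norm (a t)"
    by (rule horizontal_speed_bound[where S = S]) (use B im in auto)
  ultimately show ?thesis
    using has_integral_norm_bound_integral_component[where k = "1::real" and f = ?g and S = "{0..T}"]
    by simp
qed

section \<open>The optical length density\<close>

text \<open>The lower bound comes from the vector \<open>- p / (\<alpha> * norm p)\<close>. It lies on the boundary of the inner
  ball, hence in the sublevel set because that set is closed.\<close>

lemma sigma_star_bounds:
  fixes p :: "real^'m::finite"
  assumes "\<alpha> > 0" and lo: "ball 0 (1 / \<alpha>) \<subseteq> sublevel H x" and hi: "sublevel H x \<subseteq> ball 0 \<alpha>"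
    and cl: "closed (sublevel H x)"
  shows "bdd_above ((\<lambda>\<xi>. (- \<xi>) \<bullet> p) ` sublevel H x)"
    and "norm p \<le> \<alpha> * sigma_star H x p" and "sigma_star H x p \<le> \<alpha> * norm p"
proof -
  have bd: "(- \<xi>) \<bullet> p \<le> \<alpha> * norm p" if "\<xi> \<in> sublevel H x" for \<xi>
  proof -
    have "(- \<xi>) \<bullet> p \<le> norm (- \<xi>) * norm p" by (rule norm_cauchy_schwarz)
    also have "\<dots> \<le> \<alpha> * norm p" using hi that by (intro mult_right_mono) auto
    finally show ?thesis .
  qed
  show bdd: "bdd_above ((\<lambda>\<xi>. (- \<xi>) \<bullet> p) ` sublevel H x)" by (rule bdd_aboveI2) (rule bd)
  have "sublevel H x \<noteq> {}" using lo \<open>\<alpha> > 0\<close> by force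
  then show "sigma_star H x p \<le> \<alpha> * norm p"
    unfolding sigma_star_def by (intro cSUP_least bd)
  have cb: "cball 0 (1 / \<alpha>) \<subseteq> sublevel H x"
    using closure_minimal[OF lo cl] \<open>\<alpha> > 0\<close> by simp
  define \<xi> where "\<xi> = - ((1 / (\<alpha> * norm p)) *\<^sub>R p)"
  have "norm \<xi> \<le> 1 / \<alpha>" using \<open>\<alpha> > 0\<close> by (cases "p = 0") (auto simp: \<xi>_def)
  then have "\<xi> \<in> sublevel H x" using cb by auto
  then have "(- \<xi>) \<bullet> p \<le> sigma_star H x p"
    unfolding sigma_star_def by (intro cSUP_upper bdd)
  moreover have "\<alpha> * ((- \<xi>) \<bullet> p) = norm p"
    using \<open>\<alpha> > 0\<close> by (cases "p = 0") (auto simp: \<xi>_def power2_norm_eq_inner[symmetric] power2_eq_square)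
  ultimately show "norm p \<le> \<alpha> * sigma_star H x p"
    using \<open>\<alpha> > 0\<close> by (metis mult_left_mono less_imp_le)
qed

lemma hamiltonian_HE:
  assumes "hamiltonian_H \<Omega> H"
  obtains \<alpha> where "\<alpha> > 1" "\<And>x. x \<in> \<Omega> \<Longrightarrow> ball 0 (1 / \<alpha>) \<subseteq> sublevel H x"
    "\<And>x. x \<in> \<Omega> \<Longrightarrow> sublevel H x \<subseteq> ball 0 \<alpha>"
    "\<And>x. x \<in> \<Omega> \<Longrightarrow> closed (sublevel H x)" "\<And>x. x \<in> \<Omega> \<Longrightarrow> convex (sublevel H x)"
proof -
  obtain \<alpha> where \<alpha>: "\<alpha> > 1" "\<forall>x\<in>\<Omega>. ball 0 (1 / \<alpha>) \<subseteq> sublevel H x \<and> sublevel H x \<subseteq> ball 0 \<alpha>"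
    using assms unfolding hamiltonian_H_def by (elim conjE exE) (rule that)
  have cc: "closed (sublevel H x)" "convex (sublevel H x)" if "x \<in> \<Omega>" for x
    using assms that by (simp_all add: hamiltonian_H_def)
  show thesis by (rule that[OF \<alpha>(1) _ _ cc]) (use \<alpha>(2) in auto)
qed

lemma convex_closed_interior_dense:
  fixes Z :: "'a::euclidean_space set"
  assumes "convex Z" "closed Z" "interior Z \<noteq> {}"
    and D: "\<And>U. open U \<Longrightarrow> U \<noteq> {} \<Longrightarrow> \<exists>d\<in>D. d \<in> U"
  shows "Z \<subseteq> closure (interior Z \<inter> D)"
proof -
  have "closure D = UNIV"
    unfolding closure_approachable set_eq_iff
    using D[OF open_ball] by (metis UNIV_I ball_eq_empty closure_approachable dist_commute mem_ball not_le)
  then have "interior Z \<subseteq> closure (interior Z \<inter> D)"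
    using open_Int_closure_subset[of "interior Z" D] by simp
  then have "closure (interior Z) \<subseteq> closure (interior Z \<inter> D)"
    by (simp add: closure_minimal)
  then show ?thesis
    using convex_closure_interior[OF assms(1,3)] \<open>closed Z\<close> by (simp add: closure_closed)
qed

text \<open>A closed convex set with interior points is the closure of its interior, so a dense set of vectors
  suffices in the supremum. Vectors outside the sublevel set are assigned the value \<open>0\<close>, which is the
  contribution of the vector \<open>0\<close> of the sublevel set; this makes each entry a measurable function of the point.\<close>

lemma sigma_star_eq_countable_SUP:
  fixes p :: "real^'m::finite"
  assumes "\<alpha> > 0" and lo: "ball 0 (1 / \<alpha>) \<subseteq> sublevel H x" and hi: "sublevel H x \<subseteq> ball 0 \<alpha>"
    and cl: "closed (sublevel H x)" and cv: "convex (sublevel H x)"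
    and D: "\<And>U. open U \<Longrightarrow> U \<noteq> {} \<Longrightarrow> \<exists>d\<in>D. d \<in> U"
  shows "sigma_star H x p = (SUP \<xi>\<in>D. if H x \<xi> \<le> 0 then (- \<xi>) \<bullet> p else 0)"
    and "bdd_above ((\<lambda>\<xi>. if H x \<xi> \<le> 0 then (- \<xi>) \<bullet> p else 0) ` D)"
proof -
  let ?Z = "sublevel H x" and ?f = "\<lambda>\<xi>. if H x \<xi> \<le> 0 then (- \<xi>) \<bullet> p else 0"
  note bdd = sigma_star_bounds(1)[OF \<open>\<alpha> > 0\<close> lo hi cl, of p]
  have zero: "0 \<in> ?Z" using lo \<open>\<alpha> > 0\<close> by force
  have le: "?f \<xi> \<le> sigma_star H x p" for \<xi>
  proof (cases "\<xi> \<in> ?Z")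
    case True
    then have "?f \<xi> = (- \<xi>) \<bullet> p" by (simp add: sublevel_def)
    also have "\<dots> \<le> sigma_star H x p"
      unfolding sigma_star_def by (intro cSUP_upper bdd True)
    finally show ?thesis .
  next
    case False
    have "(- 0) \<bullet> p \<le> sigma_star H x p"
      unfolding sigma_star_def by (intro cSUP_upper bdd zero)
    then show ?thesis using False by (simp add: sublevel_def)
  qed
  show bdd': "bdd_above (?f ` D)" by (rule bdd_aboveI2) (rule le)
  have "D \<noteq> {}" using D[of UNIV] by auto
  show "sigma_star H x p = (SUP \<xi>\<in>D. ?f \<xi>)"
  proof (rule antisym)
    show "(SUP \<xi>\<in>D. ?f \<xi>) \<le> sigma_star H x p"
      using \<open>D \<noteq> {}\<close> le by (rule cSUP_least)
    have "ball 0 (1 / \<alpha>) \<subseteq> interior ?Z" using lo by (simp add: interior_maximal)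
    then have "interior ?Z \<noteq> {}" using \<open>\<alpha> > 0\<close> by force
    then have "?Z \<subseteq> closure (interior ?Z \<inter> D)"
      by (rule convex_closed_interior_dense[OF cv cl _ D])
    also have "\<dots> \<subseteq> {\<xi>. (- \<xi>) \<bullet> p \<le> (SUP \<xi>\<in>D. ?f \<xi>)}"
    proof (rule closure_minimal)
      show "closed {\<xi>. (- \<xi>) \<bullet> p \<le> (SUP \<xi>\<in>D. ?f \<xi>)}"
        by (intro closed_Collect_le continuous_intros)
      show "interior ?Z \<inter> D \<subseteq> {\<xi>. (- \<xi>) \<bullet> p \<le> (SUP \<xi>\<in>D. ?f \<xi>)}"
      proof clarify
        fix \<xi> assume \<xi>: "\<xi> \<in> interior ?Z" "\<xi> \<in> D"
        then have "\<xi> \<in> ?Z" using interior_subset by blast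
        then show "(- \<xi>) \<bullet> p \<le> (SUP \<xi>\<in>D. ?f \<xi>)"
          using cSUP_upper[OF \<xi>(2) bdd'] by (simp add: sublevel_def)
      qed
    qed
    finally show "sigma_star H x p \<le> (SUP \<xi>\<in>D. ?f \<xi>)"
      unfolding sigma_star_def using zero by (intro cSUP_least) auto
  qed
qed

lemma sigma_star_along_curve_measurable:
  fixes H :: "real^'n::finite \<Rightarrow> real^'m::finite \<Rightarrow> real"
  assumes H: "hamiltonian_H \<Omega> H" and \<gamma>: "horizontal_curve Y T \<gamma> a" and im: "\<gamma> ` {0..T} \<subseteq> \<Omega>"
  shows "(\<lambda>t. sigma_star H (\<gamma> t) (a t)) \<in> borel_measurable (lebesgue_on {0<..<T})"
proof -
  let ?M = "lebesgue_on {0<..<T}"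
  obtain D :: "(real^'m) set" where D: "countable D" "\<And>U. open U \<Longrightarrow> U \<noteq> {} \<Longrightarrow> \<exists>d\<in>D. d \<in> U"
    using that by (rule countable_dense_setE)
  obtain \<alpha> where \<alpha>: "\<alpha> > 1" "\<And>x. x \<in> \<Omega> \<Longrightarrow> ball 0 (1 / \<alpha>) \<subseteq> sublevel H x"
    "\<And>x. x \<in> \<Omega> \<Longrightarrow> sublevel H x \<subseteq> ball 0 \<alpha>"
    and cc: "\<And>x. x \<in> \<Omega> \<Longrightarrow> closed (sublevel H x)" "\<And>x. x \<in> \<Omega> \<Longrightarrow> convex (sublevel H x)"
    using that by (rule hamiltonian_HE[OF H])
  have [measurable]: "a \<in> borel_measurable ?M" using \<gamma> by (simp add: horizontal_curve_def)
  have "continuous_on {0<..<T} \<gamma>"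
    using abs_continuous_imp_continuous_on[of 0 T \<gamma>] \<gamma>
    by (auto simp: horizontal_curve_def intro: continuous_on_subset)
  then have [measurable]: "\<gamma> \<in> borel_measurable ?M"
    by (rule continuous_imp_measurable_on_sets_lebesgue) auto
  have [measurable]: "(\<lambda>t. H (\<gamma> t) \<xi>) \<in> borel_measurable ?M" for \<xi>
  proof -
    have "(\<lambda>t. (\<gamma> t, \<xi>)) \<in> measurable ?M (restrict_space borel (\<Omega> \<times> UNIV))"
    proof (rule measurable_restrict_space2)
      show "(\<lambda>t. (\<gamma> t, \<xi>)) \<in> space ?M \<rightarrow> \<Omega> \<times> UNIV" using im by auto
      show "(\<lambda>t. (\<gamma> t, \<xi>)) \<in> borel_measurable ?M" by (subst borel_prod[symmetric]) measurable
    qed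
    moreover have "(\<lambda>z. H (fst z) (snd z)) \<in> borel_measurable (restrict_space borel (\<Omega> \<times> UNIV))"
      using H by (simp add: hamiltonian_H_def)
    ultimately show ?thesis by (auto dest: measurable_compose)
  qed
  have im': "\<gamma> t \<in> \<Omega>" if "t \<in> space ?M" for t using that im by auto
  note * = sigma_star_eq_countable_SUP[OF _ \<alpha>(2,3) cc D(2)]
  have "(\<lambda>t. SUP \<xi>\<in>D. if H (\<gamma> t) \<xi> \<le> 0 then (- \<xi>) \<bullet> a t else 0) \<in> borel_measurable ?M"
    using D(1) by (rule borel_measurable_cSUP)
      (measurable, use *(2)[OF _ im' im' im' im'] \<alpha>(1) in auto)
  also have "?this \<longleftrightarrow> ?thesis"
    by (rule measurable_cong[symmetric]) (use *(1)[OF _ im' im' im' im'] \<alpha>(1) in auto)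
  finally show ?thesis .
qed

section \<open>Comparison of the optical distance with the Carnot-Caratheodory distance\<close>

text \<open>Slowing the curve down by an essential bound of its control makes it sub-unit and keeps its length.\<close>

lemma sub_unit_rescale:
  assumes \<gamma>: "horizontal_curve Y 1 \<gamma> a" and im: "\<gamma> ` {0..1} \<subseteq> \<Omega>"
  obtains T \<eta> b where "T > 0" "subunit_curve Y T \<eta> b" "\<eta> ` {0..T} \<subseteq> \<Omega>" "\<eta> 0 = \<gamma> 0" "\<eta> T = \<gamma> 1"
    "(LINT t|lebesgue_on {0<..<T}. norm (b t)) = (LINT t|lebesgue_on {0<..<1}. norm (a t))"
proof -
  from \<gamma> obtain C where C: "AE t in lebesgue_on {0<..<1}. norm (a t) \<le> C"
    unfolding horizontal_curve_def by blast
  \<comment> \<open>the maximum with \<open>1\<close> keeps the new duration positive\<close>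
  define T where "T = max C 1"
  have T: "T > 0" "1 / T > 0" "1 / (1 / T) = T" "T \<ge> C" by (auto simp: T_def)
  let ?\<eta> = "\<lambda>t. \<gamma> (1 / T * t)" and ?b = "\<lambda>t. (1 / T) *\<^sub>R a (1 / T * t)"
  show thesis
  proof (rule that)
    show "T > 0" by fact
    have "AE t in lebesgue_on {0<..<1 / (1 / T)}. norm (a (1 / T * t)) \<le> C"
      by (rule AE_lebesgue_on_rescale[OF T(2) C])
    then have "AE t in lebesgue_on {0<..<1 / (1 / T)}. norm (?b t) \<le> 1"
      by eventually_elim (use T in \<open>simp add: field_simps\<close>)
    then show "subunit_curve Y T ?\<eta> ?b"
      using horizontal_curve_rescale[OF \<gamma> T(2)] unfolding T(3) by (simp add: subunit_curve_def)
    show "?\<eta> ` {0..T} \<subseteq> \<Omega>"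
    proof clarify
      fix t assume "t \<in> {0..T}"
      then have "1 / T * t \<in> {0..1}" using T by (auto simp: field_simps)
      then show "\<gamma> (1 / T * t) \<in> \<Omega>" using im by blast
    qed
    show "(LINT t|lebesgue_on {0<..<T}. norm (?b t)) = (LINT t|lebesgue_on {0<..<1}. norm (a t))"
      using length_rescale[OF \<gamma> T(2)] unfolding T(3) .
  qed (use T in auto)
qed

lemma cc_dist_le_length:
  assumes \<gamma>: "horizontal_curve Y 1 \<gamma> a" and im: "\<gamma> ` {0..1} \<subseteq> \<Omega>"
  shows "cc_dist Y \<Omega> (\<gamma> 0) (\<gamma> 1) \<le> (LINT t|lebesgue_on {0<..<1}. norm (a t))"
proof -
  obtain T \<eta> b where "T > 0" "subunit_curve Y T \<eta> b" "\<eta> ` {0..T} \<subseteq> \<Omega>" "\<eta> 0 = \<gamma> 0" "\<eta> T = \<gamma> 1"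
    "(LINT t|lebesgue_on {0<..<T}. norm (b t)) = (LINT t|lebesgue_on {0<..<1}. norm (a t))"
    using that by (rule sub_unit_rescale[OF \<gamma> im])
  note \<eta> = this
  show ?thesis
    unfolding cc_dist_def \<eta>(6)[symmetric]
  proof (rule cInf_lower)
    show "bdd_below {LINT t|lebesgue_on {0<..<T}. norm (a t) |T \<eta> a. T > 0 \<and> subunit_curve Y T \<eta> a \<and>
        \<eta> ` {0..T} \<subseteq> \<Omega> \<and> \<eta> 0 = \<gamma> 0 \<and> \<eta> T = \<gamma> 1}"
      by (rule bdd_belowI[of _ 0]) (auto intro!: integral_nonneg_AE)
  qed (intro CollectI exI conjI, rule refl, rule \<eta>(1), rule \<eta>(2), rule \<eta>(3), rule \<eta>(4), rule \<eta>(5))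
qed

text \<open>Equivalent to each of the sets in the definitions of the two distances being nonempty.\<close>

definition connectable ::
  "('m::finite \<Rightarrow> 'n::finite vfield) \<Rightarrow> (real^'n) set \<Rightarrow> real^'n \<Rightarrow> real^'n \<Rightarrow> bool" where
  "connectable Y \<Omega> x y \<longleftrightarrow>
     (\<exists>\<gamma> a. horizontal_curve Y 1 \<gamma> a \<and> \<gamma> ` {0..1} \<subseteq> \<Omega> \<and> \<gamma> 0 = x \<and> \<gamma> 1 = y)"

lemma cc_dist_pos:
  fixes Y :: "'m::finite \<Rightarrow> 'n::finite vfield"
  assumes con: "connectable Y \<Omega> x y" and "x \<noteq> y"
    and B: "\<And>i z. z \<in> \<Omega> \<Longrightarrow> norm (Y i z) \<le> B i"
  shows "cc_dist Y \<Omega> x y > 0"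
proof -
  let ?A = "{LINT t|lebesgue_on {0<..<T}. norm (a t) |T \<gamma> a.
        T > 0 \<and> subunit_curve Y T \<gamma> a \<and> \<gamma> ` {0..T} \<subseteq> \<Omega> \<and> \<gamma> 0 = x \<and> \<gamma> T = y}"
  define M where "M = (\<Sum>i\<in>UNIV. B i) + 1"
  obtain \<gamma> a where \<gamma>: "horizontal_curve Y 1 \<gamma> a" "\<gamma> ` {0..1} \<subseteq> \<Omega>" "\<gamma> 0 = x" "\<gamma> 1 = y"
    using con unfolding connectable_def by (elim exE conjE) (rule that)
  have "\<gamma> 0 \<in> \<gamma> ` {0..1}" by simp
  then have "x \<in> \<Omega>" using \<gamma>(2,3) by auto
  then have "0 \<le> B i" for i by (rule order_trans[OF norm_ge_zero B])
  then have M: "M > 0" "(\<Sum>i\<in>UNIV. B i) \<le> M" by (auto simp: M_def intro!: add_nonneg_pos sum_nonneg)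
  have "?A \<noteq> {}"
  proof -
    obtain T \<eta> b where "T > 0" "subunit_curve Y T \<eta> b" "\<eta> ` {0..T} \<subseteq> \<Omega>" "\<eta> 0 = \<gamma> 0" "\<eta> T = \<gamma> 1"
      "(LINT t|lebesgue_on {0<..<T}. norm (b t)) = (LINT t|lebesgue_on {0<..<1}. norm (a t))"
      using that by (rule sub_unit_rescale[OF \<gamma>(1,2)])
    note \<eta> = this[unfolded \<gamma>(3,4)]
    have "(LINT t|lebesgue_on {0<..<T}. norm (b t)) \<in> ?A"
      by (intro CollectI exI conjI, rule refl, rule \<eta>(1), rule \<eta>(2), rule \<eta>(3), rule \<eta>(4), rule \<eta>(5))
    then show ?thesis by (metis empty_iff)
  qed
  moreover have "norm (y - x) / M \<le> l" if l: "l \<in> ?A" for l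
  proof -
    obtain T \<eta> b where \<eta>: "l = (LINT t|lebesgue_on {0<..<T}. norm (b t))" "T > 0" "subunit_curve Y T \<eta> b"
      "\<eta> ` {0..T} \<subseteq> \<Omega>" "\<eta> 0 = x" "\<eta> T = y"
      using l by (simp only: mem_Collect_eq) (elim exE conjE, rule that)
    have "norm (y - x) \<le> (\<Sum>i\<in>UNIV. B i) * l"
      using horizontal_displacement_le_length[of Y T \<eta> b \<Omega> B] \<eta> B by (simp add: subunit_curve_def)
    also have "\<dots> \<le> M * l" using M \<eta>(1) by (intro mult_right_mono) (auto intro!: integral_nonneg_AE)
    finally show ?thesis using M by (simp add: field_simps)
  qed
  ultimately have "norm (y - x) / M \<le> cc_dist Y \<Omega> x y"
    unfolding cc_dist_def by (rule cInf_greatest)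
  moreover have "norm (y - x) / M > 0" using \<open>x \<noteq> y\<close> M by simp
  ultimately show ?thesis by linarith
qed

lemma cc_dist_le_optical_dist:
  fixes H :: "real^'n::finite \<Rightarrow> real^'m::finite \<Rightarrow> real"
  assumes H: "hamiltonian_H \<Omega> H"
  shows "\<exists>\<alpha>>1. \<forall>x y. connectable Y \<Omega> x y \<longrightarrow> cc_dist Y \<Omega> x y \<le> \<alpha> * optical_dist Y \<Omega> H x y"
proof -
  obtain \<alpha> where \<alpha>: "\<alpha> > 1" "\<And>x. x \<in> \<Omega> \<Longrightarrow> ball 0 (1 / \<alpha>) \<subseteq> sublevel H x"
    "\<And>x. x \<in> \<Omega> \<Longrightarrow> sublevel H x \<subseteq> ball 0 \<alpha>"
    and cl: "\<And>x. x \<in> \<Omega> \<Longrightarrow> closed (sublevel H x)" "\<And>x. x \<in> \<Omega> \<Longrightarrow> convex (sublevel H x)"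
    using that by (rule hamiltonian_HE[OF H])
  have "cc_dist Y \<Omega> x y \<le> \<alpha> * optical_dist Y \<Omega> H x y" if con: "connectable Y \<Omega> x y" for x y
  proof -
    let ?A = "{LINT t|lebesgue_on {0<..<1}. sigma_star H (\<gamma> t) (a t) |\<gamma> a.
      horizontal_curve Y 1 \<gamma> a \<and> \<gamma> ` {0..1} \<subseteq> \<Omega> \<and> \<gamma> 0 = x \<and> \<gamma> 1 = y}"
    have "?A \<noteq> {}" using con unfolding connectable_def by auto
    moreover have "cc_dist Y \<Omega> x y / \<alpha> \<le> l" if l: "l \<in> ?A" for l
    proof -
      obtain \<gamma> a where l: "l = (LINT t|lebesgue_on {0<..<1}. sigma_star H (\<gamma> t) (a t))"
        and \<gamma>: "horizontal_curve Y 1 \<gamma> a" "\<gamma> ` {0..1} \<subseteq> \<Omega>" "\<gamma> 0 = x" "\<gamma> 1 = y"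
        using l by (simp only: mem_Collect_eq) (elim exE conjE, rule that)
      let ?M = "lebesgue_on {0<..<1::real}"
      have im: "\<gamma> t \<in> \<Omega>" if "t \<in> space ?M" for t using that \<gamma>(2) by auto
      have b: "norm (a t) \<le> \<alpha> * sigma_star H (\<gamma> t) (a t)" "sigma_star H (\<gamma> t) (a t) \<le> \<alpha> * norm (a t)"
        if "t \<in> space ?M" for t
        using sigma_star_bounds(2,3)[OF _ \<alpha>(2,3) cl(1), OF _ im im im, OF _ that that that] \<alpha>(1) by auto
      have int: "integrable ?M (\<lambda>t. \<alpha> * norm (a t))"
        using horizontal_curve_control_integrable[OF \<gamma>(1)] by simp
      have int\<sigma>: "integrable ?M (\<lambda>t. sigma_star H (\<gamma> t) (a t))"
      proof (rule Bochner_Integration.integrable_bound[OF int])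
        show "(\<lambda>t. sigma_star H (\<gamma> t) (a t)) \<in> borel_measurable ?M"
          by (rule sigma_star_along_curve_measurable[OF H \<gamma>(1,2)])
        show "AE t in ?M. norm (sigma_star H (\<gamma> t) (a t)) \<le> norm (\<alpha> * norm (a t))"
        proof (rule AE_I2)
          fix t assume t: "t \<in> space ?M"
          have "0 \<le> \<alpha> * sigma_star H (\<gamma> t) (a t)" using b(1)[OF t] norm_ge_zero order_trans by blast
          then have "0 \<le> sigma_star H (\<gamma> t) (a t)" using \<alpha>(1) by (simp add: zero_le_mult_iff)
          then show "norm (sigma_star H (\<gamma> t) (a t)) \<le> norm (\<alpha> * norm (a t))"
            using b(2)[OF t] \<alpha>(1) by simp
        qed
      qed
      have "cc_dist Y \<Omega> x y \<le> (LINT t|?M. norm (a t))"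
        using cc_dist_le_length[OF \<gamma>(1,2)] \<gamma>(3,4) by simp
      also have "\<dots> \<le> (LINT t|?M. \<alpha> * sigma_star H (\<gamma> t) (a t))"
        using horizontal_curve_control_integrable[OF \<gamma>(1)] int\<sigma> b(1)
        by (intro integral_mono) auto
      also have "\<dots> = \<alpha> * l" using l by simp
      finally show ?thesis using \<alpha>(1) by (simp add: field_simps)
    qed
    ultimately have "cc_dist Y \<Omega> x y / \<alpha> \<le> optical_dist Y \<Omega> H x y"
      unfolding optical_dist_def by (rule cInf_greatest)
    then show ?thesis using \<alpha>(1) by (simp add: field_simps)
  qed
  with \<alpha>(1) show ?thesis by auto
qed

section \<open>Translations and left-invariant fields\<close>

lemma smooth_imp_C1:
  assumes "smooth f"
  shows "(f has_derivative frechet_derivative f (at x)) (at x)"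
    and "continuous_on UNIV (\<lambda>x. frechet_derivative f (at x) v)"
proof -
  have "C_k (Suc 0) f" using assms unfolding smooth_def by blast
  then have "f differentiable (at x)" "C_k 0 (\<lambda>x. frechet_derivative f (at x) v)"
    unfolding C_k.simps by blast+
  then show "(f has_derivative frechet_derivative f (at x)) (at x)"
    "continuous_on UNIV (\<lambda>x. frechet_derivative f (at x) v)"
    by (simp_all add: frechet_derivative_works)
qed

lemma smooth_imp_continuous_on: "smooth f \<Longrightarrow> continuous_on S f"
  unfolding smooth_def by (metis C_k.simps(1) continuous_on_subset subset_UNIV)

text \<open>Joint continuity in the base point and the direction; the definition of smoothness provides continuity
  for each fixed direction, and the directions of a basis are enough.\<close>

lemma continuous_on_frechet_derivative:
  fixes f :: "'a::euclidean_space \<Rightarrow> 'b::euclidean_space"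
  assumes "smooth f" and p: "continuous_on S p" and q: "continuous_on S q"
  shows "continuous_on S (\<lambda>x. frechet_derivative f (at (p x)) (q x))"
proof -
  have lin: "linear (frechet_derivative f (at y))" for y
    using smooth_imp_C1(1)[OF \<open>smooth f\<close>] has_derivative_linear by blast
  have expand: "frechet_derivative f (at y) v = (\<Sum>b\<in>Basis. (v \<bullet> b) *\<^sub>R frechet_derivative f (at y) b)" for y v
  proof -
    have "frechet_derivative f (at y) (\<Sum>b\<in>Basis. (v \<bullet> b) *\<^sub>R b) =
        (\<Sum>b\<in>Basis. (v \<bullet> b) *\<^sub>R frechet_derivative f (at y) b)"
      by (simp add: linear_sum[OF lin] linear_scale[OF lin])
    then show ?thesis by (simp add: euclidean_representation)
  qed
  have "continuous_on S (\<lambda>x. \<Sum>b\<in>Basis. (q x \<bullet> b) *\<^sub>R frechet_derivative f (at (p x)) b)"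
    by (intro continuous_on_sum continuous_on_scaleR continuous_on_inner q continuous_on_const
        continuous_on_compose2[OF smooth_imp_C1(2)[OF \<open>smooth f\<close>] p]) auto
  also have "(\<lambda>x. \<Sum>b\<in>Basis. (q x \<bullet> b) *\<^sub>R frechet_derivative f (at (p x)) b) =
      (\<lambda>x. frechet_derivative f (at (p x)) (q x))"
    by (rule ext) (rule expand[symmetric])
  finally show ?thesis .
qed

context Rn_lie_group
begin

lemma mem_carrier [simp]: "x \<in> carrier G"
  by (simp add: carrier_UNIV)

abbreviation mult_deriv :: "real^'n \<Rightarrow> real^'n \<Rightarrow> (real^'n) \<times> (real^'n) \<Rightarrow> real^'n" where
  "mult_deriv x y \<equiv> frechet_derivative (\<lambda>p. fst p \<otimes> snd p) (at (x, y))"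

text \<open>The partial derivatives of the multiplication: \<open>right_deriv z x\<close> is the derivative of the right translation by
  \<open>z\<close> at \<open>x\<close>, and \<open>left_deriv g x\<close> that of the left translation by \<open>g\<close> at \<open>x\<close>.\<close>

definition right_deriv :: "real^'n \<Rightarrow> real^'n \<Rightarrow> real^'n \<Rightarrow> real^'n" where
  "right_deriv z x v = mult_deriv x z (v, 0)"

definition left_deriv :: "real^'n \<Rightarrow> real^'n \<Rightarrow> real^'n \<Rightarrow> real^'n" where
  "left_deriv g x v = mult_deriv g x (0, v)"

lemma has_derivative_mult:
  assumes "(f has_derivative f') (at x within S)" and "(g has_derivative g') (at x within S)"
  shows "((\<lambda>x. f x \<otimes> g x) has_derivative (\<lambda>v. mult_deriv (f x) (g x) (f' v, g' v))) (at x within S)"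
  using has_derivative_in_compose[OF has_derivative_Pair[OF assms]
      has_derivative_at_withinI[OF smooth_imp_C1(1)[OF smooth_mult]]]
  by simp

lemma mult_deriv_split: "mult_deriv x y (u, v) = right_deriv y x u + left_deriv x y v"
proof -
  have "linear (mult_deriv x y)"
    using smooth_imp_C1(1)[OF smooth_mult] has_derivative_linear by blast
  from linear_add[OF this, of "(u, 0)" "(0, v)"] show ?thesis
    by (simp add: right_deriv_def left_deriv_def)
qed

lemma has_derivative_right: "((\<lambda>x. x \<otimes> z) has_derivative right_deriv z x) (at x within S)"
  unfolding right_deriv_def[abs_def]
  by (rule has_derivative_mult[OF has_derivative_ident has_derivative_const])

lemma has_derivative_left: "((\<lambda>y. g \<otimes> y) has_derivative left_deriv g y) (at y within S)"
  unfolding left_deriv_def[abs_def]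
  by (rule has_derivative_mult[OF has_derivative_const has_derivative_ident])

lemma linear_right_deriv: "linear (right_deriv z x)"
  using has_derivative_right has_derivative_linear by blast

lemma right_deriv_comp: "right_deriv z' (x \<otimes> z) (right_deriv z x v) = right_deriv (z \<otimes> z') x v"
proof -
  have "((\<lambda>y. (y \<otimes> z) \<otimes> z') has_derivative (\<lambda>v. right_deriv z' (x \<otimes> z) (right_deriv z x v))) (at x)"
    using has_derivative_compose[OF has_derivative_right has_derivative_right] .
  moreover have "((\<lambda>y. (y \<otimes> z) \<otimes> z') has_derivative right_deriv (z \<otimes> z') x) (at x)"
    using has_derivative_right[of "z \<otimes> z'" x UNIV] by (simp add: m_assoc)
  ultimately show ?thesis using has_derivative_unique by metis
qed

lemma right_deriv_one [simp]: "right_deriv \<one> x v = v"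
proof -
  have "((\<lambda>y. y) has_derivative right_deriv \<one> x) (at x)"
    using has_derivative_right[of "\<one>" x UNIV] by simp
  then show ?thesis using has_derivative_ident has_derivative_unique by metis
qed

lemma left_deriv_one [simp]: "left_deriv \<one> x v = v"
proof -
  have "((\<lambda>y. y) has_derivative left_deriv \<one> x) (at x)"
    using has_derivative_left[of "\<one>" x UNIV] by simp
  then show ?thesis using has_derivative_ident has_derivative_unique by metis
qed

lemma continuous_on_mult_group:
  assumes "continuous_on S f" "continuous_on S g"
  shows "continuous_on S (\<lambda>x. f x \<otimes> g x)"
  using continuous_on_compose2[OF smooth_imp_continuous_on[OF smooth_mult, of UNIV] continuous_on_Pair[OF assms]]
  by simp

lemma continuous_on_inv_group:
  "continuous_on S f \<Longrightarrow> continuous_on S (\<lambda>x. inv (f x))"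
  using continuous_on_compose2[OF smooth_imp_continuous_on[OF smooth_inv, of UNIV]] by simp

lemma continuous_on_right_deriv:
  assumes "continuous_on S z" "continuous_on S x" "continuous_on S v"
  shows "continuous_on S (\<lambda>t. right_deriv (z t) (x t) (v t))"
  unfolding right_deriv_def
  by (intro continuous_on_frechet_derivative[OF smooth_mult] continuous_on_Pair assms continuous_on_const)

lemma left_invariant_eq:
  assumes "V \<in> left_invariant_fields G"
  shows "left_deriv g x (V x) = V (g \<otimes> x)"
proof -
  have "frechet_derivative (\<lambda>y. g \<otimes> y) (at x) = left_deriv g x"
    using has_derivative_left frechet_derivative_at by metis
  moreover have "frechet_derivative (\<lambda>y. g \<otimes> y) (at x) (V x) = V (g \<otimes> x)"
    using assms by (simp add: left_invariant_fields_def)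
  ultimately show ?thesis by simp
qed

lemma left_invariant_smooth: "V \<in> left_invariant_fields G \<Longrightarrow> smooth V"
  by (simp add: left_invariant_fields_def)

lemma left_invariant_zero:
  assumes "V \<in> left_invariant_fields G" and "V \<one> = 0"
  shows "V = 0"
proof
  fix x
  have "linear (left_deriv x \<one>)" using has_derivative_left has_derivative_linear by blast
  then show "V x = 0 x"
    using left_invariant_eq[OF assms(1), of x \<one>] assms(2) by (simp add: linear_0)
qed

lemma translate_integral_curve:
  assumes X: "X \<in> left_invariant_fields G"
    and c: "(c has_vector_derivative r *\<^sub>R X (c t)) (at t within S)"
  shows "((\<lambda>t. g \<otimes> c t) has_vector_derivative r *\<^sub>R X (g \<otimes> c t)) (at t within S)"
proof -
  have "linear (left_deriv g (c t))" using has_derivative_left has_derivative_linear by blast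
  then have *: "left_deriv g (c t) (s *\<^sub>R r *\<^sub>R X (c t)) = s *\<^sub>R r *\<^sub>R X (g \<otimes> c t)" for s
    by (simp only: linear_scale left_invariant_eq[OF X])
  show ?thesis
    using has_derivative_compose[OF c[unfolded has_vector_derivative_def] has_derivative_left[of g]]
    unfolding has_vector_derivative_def * .
qed

section \<open>The Lie derivative along a left-invariant field\<close>

text \<open>The flow of a left-invariant field \<open>X\<close> is right translation by \<open>c t\<close>, and its derivative in the base point has
  time derivative \<open>DX\<close> at time \<open>0\<close>. The two derivatives are interchanged by differentiating the integral
  equation of the flow first in the base point, under the integral sign, and then in time.\<close>

lemma right_deriv_along_flow:
  assumes X: "X \<in> left_invariant_fields G" and c0: "c 0 = \<one>"
    and c: "\<And>t::real. (c has_vector_derivative X (c t)) (at t)"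
  shows "((\<lambda>t. right_deriv (c t) x \<eta>) has_vector_derivative frechet_derivative X (at x) \<eta>)
    (at 0 within {0..1})"
proof -
  let ?D = "\<lambda>y. frechet_derivative X (at y)"
  \<comment> \<open>a line through \<open>x\<close> in the direction \<open>\<eta>\<close>, along which the base point is differentiated\<close>
  let ?p = "\<lambda>s. x + s *\<^sub>R \<eta>"
  note smX = left_invariant_smooth[OF X]
  have contc: "continuous_on S c" for S
    using c by (meson continuous_at_imp_continuous_on has_vector_derivative_continuous)
  have contc': "continuous_on S (\<lambda>y. c (f y))" if "continuous_on S f" for S and f :: "'z::topological_space \<Rightarrow> real"
    using continuous_on_compose2[OF contc[of UNIV] that] by simp
  have cg: "((\<lambda>t. g \<otimes> c t) has_vector_derivative X (g \<otimes> c t)) (at t within S)" for g t S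
    using translate_integral_curve[OF X, of c 1 t S g] c[of t] by (simp add: has_vector_derivative_at_within)
  let ?F = "\<lambda>s \<tau>. ?D (?p s \<otimes> c \<tau>) (right_deriv (c \<tau>) (?p s) \<eta>)"
  have FTC: "?p s \<otimes> c t = ?p s + integral {0..t} (\<lambda>\<tau>. X (?p s \<otimes> c \<tau>))" if "0 \<le> t" for s t
  proof -
    have "((\<lambda>\<tau>. X (?p s \<otimes> c \<tau>)) has_integral (?p s \<otimes> c t - ?p s \<otimes> c 0)) {0..t}"
      by (rule fundamental_theorem_of_calculus[OF that]) (rule cg)
    then show ?thesis by (simp add: c0 integral_unique)
  qed
  have int: "right_deriv (c t) x \<eta> = \<eta> + integral {0..t} (?F 0)" if "0 \<le> t" for t
  proof -
    have p: "(?p has_vector_derivative \<eta>) (at s)" for s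
      by (auto intro!: derivative_eq_intros simp: has_vector_derivative_def)
    have right: "((\<lambda>s. ?p s \<otimes> z) has_vector_derivative right_deriv z (?p s) \<eta>) (at s)" for s z
      using has_derivative_compose[OF p[unfolded has_vector_derivative_def] has_derivative_right]
      by (simp add: has_vector_derivative_def linear_scale[OF linear_right_deriv])
    have "((\<lambda>s. integral (cbox 0 t) (\<lambda>\<tau>. X (?p s \<otimes> c \<tau>))) has_vector_derivative
        integral (cbox 0 t) (?F 0)) (at 0 within UNIV)"
    proof (rule leibniz_rule_vector_derivative)
      fix s \<tau>
      have "((\<lambda>s. X (?p s \<otimes> c \<tau>)) has_derivative (\<lambda>r. ?D (?p s \<otimes> c \<tau>) (r *\<^sub>R right_deriv (c \<tau>) (?p s) \<eta>))) (at s)"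
        using has_derivative_compose[OF right[unfolded has_vector_derivative_def] smooth_imp_C1(1)[OF smX]] .
      then show "((\<lambda>s. X (?p s \<otimes> c \<tau>)) has_vector_derivative ?F s \<tau>) (at s within UNIV)"
        using linear_scale[OF has_derivative_linear[OF smooth_imp_C1(1)[OF smX]]]
        by (simp add: has_vector_derivative_def)
    next
      fix s :: real
      show "(\<lambda>\<tau>. X (?p s \<otimes> c \<tau>)) integrable_on cbox 0 t"
        by (intro integrable_continuous continuous_on_compose2[OF smooth_imp_continuous_on[OF smX, of UNIV]]
            continuous_on_mult_group contc continuous_on_const) auto
    next
      have "continuous_on (UNIV \<times> cbox 0 t) (\<lambda>q. ?F (fst q) (snd q))"
        by (intro continuous_on_frechet_derivative[OF smX] continuous_on_mult_group
            continuous_on_right_deriv contc' continuous_intros)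
      then show "continuous_on (UNIV \<times> cbox 0 t) (\<lambda>(s, \<tau>). ?F s \<tau>)"
        by (simp add: case_prod_unfold)
    qed auto
    then have "((\<lambda>s. ?p s + integral {0..t} (\<lambda>\<tau>. X (?p s \<otimes> c \<tau>))) has_vector_derivative
        \<eta> + integral {0..t} (?F 0)) (at 0)"
      using p[of 0] by (intro has_vector_derivative_add) (auto simp: cbox_interval)
    then have "((\<lambda>s. ?p s \<otimes> c t) has_vector_derivative \<eta> + integral {0..t} (?F 0)) (at 0)"
      unfolding FTC[OF that, symmetric] .
    moreover have "((\<lambda>s. ?p s \<otimes> c t) has_vector_derivative right_deriv (c t) x \<eta>) (at 0)"
      using right[of "c t" 0] by simp
    ultimately show ?thesis by (rule vector_derivative_unique_at[rotated])
  qed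
  have "continuous_on {0..1} (?F 0)"
    by (intro continuous_on_frechet_derivative[OF smX] continuous_on_mult_group
        continuous_on_right_deriv contc continuous_intros)
  then have "((\<lambda>t. integral {0..t} (?F 0)) has_vector_derivative ?F 0 0) (at 0 within {0..1})"
    by (rule integral_has_vector_derivative) simp
  then have "((\<lambda>t. \<eta> + integral {0..t} (?F 0)) has_vector_derivative ?F 0 0) (at 0 within {0..1})"
    using has_vector_derivative_add[OF has_vector_derivative_const] by fastforce
  then have "((\<lambda>t. right_deriv (c t) x \<eta>) has_vector_derivative ?F 0 0) (at 0 within {0..1})"
    by (rule has_vector_derivative_transform[rotated 2]) (use int in auto)
  then show ?thesis by (simp add: c0)
qed

text \<open>The pull-back of \<open>Y\<close> under the flow of \<open>X\<close> has the Lie bracket as its derivative. Pushing \<open>Y x\<close> forward, instead of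
  pulling \<open>Y (x \<otimes> c t)\<close> back, avoids differentiating an inverse.\<close>

lemma lie_derivative:
  assumes X: "X \<in> left_invariant_fields G" and Y: "smooth Y" and c0: "c 0 = \<one>"
    and c: "\<And>t::real. (c has_vector_derivative X (c t)) (at t)"
  shows "((\<lambda>t. Y (x \<otimes> c t) - right_deriv (c t) x (Y x)) has_vector_derivative lie_bracket X Y x)
    (at 0 within {0..1})"
proof -
  have "((\<lambda>t. x \<otimes> c t) has_vector_derivative X x) (at 0 within {0..1})"
    using translate_integral_curve[OF X, of c 1 0 "{0..1}" x] c[of 0] c0
    by (simp add: has_vector_derivative_at_within)
  moreover have "(Y has_derivative frechet_derivative Y (at x)) (at (x \<otimes> c 0))"
    using smooth_imp_C1(1)[OF Y, of x] c0 by simp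
  ultimately have "((\<lambda>t. Y (x \<otimes> c t)) has_derivative (\<lambda>r. frechet_derivative Y (at x) (r *\<^sub>R X x))) (at 0 within {0..1})"
    unfolding has_vector_derivative_def by (rule has_derivative_compose)
  then
  have "((\<lambda>t. Y (x \<otimes> c t)) has_vector_derivative frechet_derivative Y (at x) (X x)) (at 0 within {0..1})"
    by (simp add: has_vector_derivative_def c0 linear_scale[OF has_derivative_linear[OF smooth_imp_C1(1)[OF Y]]])
  from has_vector_derivative_diff[OF this right_deriv_along_flow[OF X c0 c]]
  show ?thesis by (simp add: lie_bracket_def)
qed

text \<open>The right-invariant one-form whose value at the identity is the covector \<open>\<xi>\<close>.\<close>

definition right_form :: "real^'n \<Rightarrow> real^'n \<Rightarrow> real^'n \<Rightarrow> real" where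
  "right_form \<xi> x v = \<xi> \<bullet> right_deriv (inv x) x v"

lemma linear_right_form: "linear (right_form \<xi> x)"
  using linear_compose[OF linear_right_deriv bounded_linear.linear[OF bounded_linear_inner_right]]
  by (simp add: right_form_def[abs_def] o_def)

lemma right_form_translate: "right_form \<xi> (x \<otimes> z) (right_deriv z x v) = right_form \<xi> x v"
  by (simp add: right_form_def right_deriv_comp inv_mult_group m_assoc[symmetric])

text \<open>A right-invariant form is preserved by the flow of a left-invariant field. So if it vanishes on \<open>Y\<close>
  along a flow line of \<open>X\<close>, it also vanishes on the difference of \<open>Y\<close> and its push-forward, and in the limit on the
  Lie derivative of \<open>Y\<close>.\<close>

lemma right_form_lie_bracket:
  assumes X: "X \<in> left_invariant_fields G" and Y: "smooth Y" and c0: "c 0 = \<one>"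
    and c: "\<And>t::real. (c has_vector_derivative X (c t)) (at t)"
    and "\<delta> > 0" and van: "\<And>t. 0 \<le> t \<Longrightarrow> t < \<delta> \<Longrightarrow> right_form \<xi> (x \<otimes> c t) (Y (x \<otimes> c t)) = 0"
  shows "right_form \<xi> x (lie_bracket X Y x) = 0"
proof -
  let ?\<phi> = "\<lambda>t. Y (x \<otimes> c t) - right_deriv (c t) x (Y x)"
  have contc: "continuous_on S c" for S
    using c by (meson continuous_at_imp_continuous_on has_vector_derivative_continuous)
  have zero: "right_form \<xi> x (Y x) = 0" using van[of 0] \<open>\<delta> > 0\<close> c0 by simp
  have van': "right_form \<xi> (x \<otimes> c t) (inverse t *\<^sub>R ?\<phi> t) = 0" if "0 \<le> t" "t < \<delta>" for t
    using van[OF that] zero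
    by (simp add: linear_scale[OF linear_right_form] linear_diff[OF linear_right_form] right_form_translate)
  let ?\<psi> = "\<lambda>t. if t = 0 then lie_bracket X Y x else inverse t *\<^sub>R ?\<phi> t"
  let ?f = "\<lambda>t. right_form \<xi> (x \<otimes> c t) (?\<psi> t)"
  have \<psi>: "(?\<psi> \<longlongrightarrow> lie_bracket X Y x) (at 0 within {0..1})"
  proof -
    have "((\<lambda>t. ((?\<phi> t - ?\<phi> 0) - t *\<^sub>R lie_bracket X Y x) /\<^sub>R norm t) \<longlongrightarrow> 0) (at 0 within {0..1})"
      using lie_derivative[OF X Y c0 c, of x]
      by (simp add: has_vector_derivative_def has_derivative_at_within)
    then have "((\<lambda>t. ?\<psi> t - lie_bracket X Y x) \<longlongrightarrow> 0) (at 0 within {0..1})"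
    proof (rule Lim_transform_within[where d = 1])
      fix t :: real assume "t \<in> {0..1}" "0 < dist t 0" "dist t 0 < 1"
      then show "((?\<phi> t - ?\<phi> 0) - t *\<^sub>R lie_bracket X Y x) /\<^sub>R norm t = ?\<psi> t - lie_bracket X Y x"
        by (simp add: c0 scaleR_diff_right)
    qed simp
    then show ?thesis by (simp add: LIM_zero_iff)
  qed
  have "(?f \<longlongrightarrow> ?f 0) (at 0 within {0..1})"
  proof -
    have "continuous_on UNIV (\<lambda>q. right_form \<xi> (fst q) (snd q))"
      unfolding right_form_def
      by (intro continuous_on_right_deriv continuous_on_inv_group continuous_intros)
    moreover have "((\<lambda>t. (x \<otimes> c t, ?\<psi> t)) \<longlongrightarrow> (x \<otimes> c 0, ?\<psi> 0)) (at 0 within {0..1})"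
    proof (rule tendsto_Pair)
      have "continuous_on {0..1} (\<lambda>t. x \<otimes> c t)"
        by (intro continuous_on_mult_group contc continuous_on_const)
      then show "((\<lambda>t. x \<otimes> c t) \<longlongrightarrow> x \<otimes> c 0) (at 0 within {0..1})"
        by (simp add: continuous_on)
    qed (use \<psi> in simp)
    ultimately show ?thesis
      using continuous_on_tendsto_compose[of UNIV "\<lambda>q. right_form \<xi> (fst q) (snd q)"
          "\<lambda>t. (x \<otimes> c t, ?\<psi> t)" "(x \<otimes> c 0, ?\<psi> 0)" "at 0 within {0..1}"] by simp
  qed
  moreover have "(?f \<longlongrightarrow> 0) (at 0 within {0..1})"
  proof (rule Lim_transform_within[OF tendsto_const \<open>\<delta> > 0\<close>])
    fix t :: real assume "t \<in> {0..1}" "0 < dist t 0" "dist t 0 < \<delta>"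
    then show "0 = ?f t" using van'[of t] by (simp add: dist_real_def)
  qed
  moreover have "at (0::real) within {0..1} \<noteq> bot" by (simp add: trivial_limit_within islimpt_Icc)
  ultimately have "?f 0 = 0" using tendsto_unique by blast
  then show ?thesis by (simp add: c0)
qed

end

section \<open>Piecewise smooth horizontal paths\<close>

text \<open>The curves built in the proof of the Chow-Rashevskii theorem are finite concatenations of smooth ones. For
  these, a Lipschitz bound and a finite exceptional set are preserved by concatenation more simply than
  absolute continuity and a null set.\<close>

definition horizontal_path ::
  "('m::finite \<Rightarrow> 'n::finite vfield) \<Rightarrow> real \<Rightarrow> (real \<Rightarrow> real^'n) \<Rightarrow> (real \<Rightarrow> real^'m) \<Rightarrow> bool" where
  "horizontal_path Y T \<gamma> a \<longleftrightarrow>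
     0 \<le> T \<and> (\<exists>L. L-lipschitz_on {0..T} \<gamma>) \<and> a \<in> borel_measurable borel \<and> (\<forall>t. norm (a t) \<le> 1) \<and>
     (\<exists>F. finite F \<and> (\<forall>t\<in>{0<..<T} - F.
        (\<gamma> has_vector_derivative (\<Sum>i\<in>UNIV. a t $ i *\<^sub>R Y i (\<gamma> t))) (at t)))"

lemma horizontal_path_const: "horizontal_path Y 0 (\<lambda>_. x) (\<lambda>_. 0)"
  unfolding horizontal_path_def
  by (auto intro!: exI[of _ 0] simp: lipschitz_on_def)

lemma horizontal_path_concat:
  assumes 1: "horizontal_path Y S \<gamma> a" and 2: "horizontal_path Y T \<eta> b" and eq: "\<gamma> S = \<eta> 0"
  shows "horizontal_path Y (S + T) (\<lambda>t. if t \<le> S then \<gamma> t else \<eta> (t - S))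
    (\<lambda>t. if t \<le> S then a t else b (t - S))" (is "horizontal_path Y _ ?\<gamma> ?a")
proof -
  from 1 obtain L F where L: "L-lipschitz_on {0..S} \<gamma>" and F: "finite F" and S: "0 \<le> S"
    and dF: "\<forall>t\<in>{0<..<S} - F. (\<gamma> has_vector_derivative (\<Sum>i\<in>UNIV. a t $ i *\<^sub>R Y i (\<gamma> t))) (at t)"
    and [measurable]: "a \<in> borel_measurable borel" and a: "\<forall>t. norm (a t) \<le> 1"
    unfolding horizontal_path_def by (elim conjE exE) (rule that)
  from 2 obtain M H where M: "M-lipschitz_on {0..T} \<eta>" and H: "finite H" and T: "0 \<le> T"
    and dH: "\<forall>t\<in>{0<..<T} - H. (\<eta> has_vector_derivative (\<Sum>i\<in>UNIV. b t $ i *\<^sub>R Y i (\<eta> t))) (at t)"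
    and [measurable]: "b \<in> borel_measurable borel" and b: "\<forall>t. norm (b t) \<le> 1"
    unfolding horizontal_path_def by (elim conjE exE) (rule that)
  have "(max L M)-lipschitz_on {0..S + T} ?\<gamma>"
  proof (rule lipschitz_on_concat)
    show "(max L M)-lipschitz_on {0..S} \<gamma>" using L by (rule lipschitz_on_le) simp
    have "M-lipschitz_on {S..S + T} (\<lambda>t. \<eta> (t - S))"
    proof (rule lipschitz_onI)
      fix x y assume "x \<in> {S..S + T}" "y \<in> {S..S + T}"
      then show "dist (\<eta> (x - S)) (\<eta> (y - S)) \<le> M * dist x y"
        using lipschitz_onD[OF M, of "x - S" "y - S"] by (simp add: dist_real_def)
    qed (use M in \<open>rule lipschitz_on_nonneg\<close>)
    then show "(max L M)-lipschitz_on {S..S + T} (\<lambda>t. \<eta> (t - S))" by (rule lipschitz_on_le) simp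
  qed (use eq in simp)
  moreover have "?a \<in> borel_measurable borel" by measurable
  \<comment> \<open>the time \<open>S\<close> of the corner is added to the exceptional set\<close>
  moreover have "(?\<gamma> has_vector_derivative (\<Sum>i\<in>UNIV. ?a t $ i *\<^sub>R Y i (?\<gamma> t))) (at t)"
    if t: "t \<in> {0<..<S + T} - (insert S (F \<union> (\<lambda>t. t + S) ` H))" for t
  proof (cases "t < S")
    case True
    then have "(\<gamma> has_vector_derivative (\<Sum>i\<in>UNIV. a t $ i *\<^sub>R Y i (\<gamma> t))) (at t)"
      using t dF by auto
    then have "(?\<gamma> has_vector_derivative (\<Sum>i\<in>UNIV. a t $ i *\<^sub>R Y i (\<gamma> t))) (at t)"
      by (rule has_vector_derivative_transform_within_open[of _ _ _ "{..<S}"]) (use True in auto)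
    then show ?thesis using True by simp
  next
    case False
    then have gt: "S < t" using t by auto
    have "t - S \<notin> H" using t by (auto simp: image_iff algebra_simps)
    then have "(\<eta> has_vector_derivative (\<Sum>i\<in>UNIV. b (t - S) $ i *\<^sub>R Y i (\<eta> (t - S)))) (at (t - S))"
      using t gt dH by auto
    moreover have "((\<lambda>t. t - S) has_vector_derivative 1) (at t)"
      by (auto intro!: derivative_eq_intros simp: has_vector_derivative_def)
    ultimately have "((\<lambda>t. \<eta> (t - S)) has_vector_derivative (\<Sum>i\<in>UNIV. b (t - S) $ i *\<^sub>R Y i (\<eta> (t - S)))) (at t)"
      using vector_diff_chain_at[of "\<lambda>t. t - S" 1 t \<eta>] by (simp add: o_def)
    then have "(?\<gamma> has_vector_derivative (\<Sum>i\<in>UNIV. b (t - S) $ i *\<^sub>R Y i (\<eta> (t - S)))) (at t)"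
      by (rule has_vector_derivative_transform_within_open[of _ _ _ "{S<..}"]) (use gt in auto)
    then show ?thesis using gt by simp
  qed
  moreover have "finite (insert S (F \<union> (\<lambda>t. t + S) ` H))" using F H by simp
  ultimately show ?thesis
    unfolding horizontal_path_def using S T a b
    by (intro conjI exI[of _ "max L M"] exI[of _ "insert S (F \<union> (\<lambda>t. t + S) ` H)"] ballI) auto
qed

lemma horizontal_path_imp_curve:
  assumes "horizontal_path Y T \<gamma> a"
  shows "horizontal_curve Y T \<gamma> a"
proof -
  from assms obtain L F where L: "L-lipschitz_on {0..T} \<gamma>" and F: "finite F"
    and dF: "\<forall>t\<in>{0<..<T} - F. (\<gamma> has_vector_derivative (\<Sum>i\<in>UNIV. a t $ i *\<^sub>R Y i (\<gamma> t))) (at t)"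
    and m: "a \<in> borel_measurable borel" and a: "\<forall>t. norm (a t) \<le> 1"
    unfolding horizontal_path_def by (elim conjE exE) (rule that)
  have "a \<in> borel_measurable lebesgue" using m by (simp add: measurable_completion)
  then have "a \<in> borel_measurable (lebesgue_on {0<..<T})" by (rule measurable_restrict_space1)
  moreover have "AE t in lebesgue_on {0<..<T}. (\<gamma> has_vector_derivative (\<Sum>i\<in>UNIV. a t $ i *\<^sub>R Y i (\<gamma> t))) (at t)"
    by (subst AE_lebesgue_on_negligible) (use dF F in \<open>auto intro!: exI[of _ F]\<close>)
  ultimately show ?thesis
    unfolding horizontal_curve_def using lipschitz_imp_abs_continuous[OF L] a by (auto intro!: exI[of _ 1])
qed

lemma horizontal_path_subpath:
  assumes "horizontal_path Y T \<gamma> a" and "0 \<le> S" "S \<le> T"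
  shows "horizontal_path Y S \<gamma> a"
proof -
  from assms(1) obtain L F where L: "L-lipschitz_on {0..T} \<gamma>" and F: "finite F"
    and dF: "\<forall>t\<in>{0<..<T} - F. (\<gamma> has_vector_derivative (\<Sum>i\<in>UNIV. a t $ i *\<^sub>R Y i (\<gamma> t))) (at t)"
    and m: "a \<in> borel_measurable borel" and a: "\<forall>t. norm (a t) \<le> 1"
    unfolding horizontal_path_def by (elim conjE exE) (rule that)
  have "L-lipschitz_on {0..S} \<gamma>" using L by (rule lipschitz_on_subset) (use assms in auto)
  then show ?thesis
    unfolding horizontal_path_def using assms F dF m a by (auto intro!: exI[of _ L] exI[of _ F])
qed

text \<open>The fields are bounded on the ball only, so the estimate is applied up to the first time at which
  the path leaves the open ball: until then it is too short to have reached the sphere.\<close>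

lemma horizontal_path_stays_in_ball:
  fixes Y :: "'m::finite \<Rightarrow> 'n::finite vfield"
  assumes \<gamma>: "horizontal_path Y T \<gamma> a" and "\<rho> > 0"
    and B: "\<And>i z. z \<in> cball (\<gamma> 0) \<rho> \<Longrightarrow> norm (Y i z) \<le> B i" and T: "(\<Sum>i\<in>UNIV. B i) * T < \<rho>"
  shows "\<gamma> ` {0..T} \<subseteq> ball (\<gamma> 0) \<rho>"
proof (rule ccontr)
  assume "\<not> \<gamma> ` {0..T} \<subseteq> ball (\<gamma> 0) \<rho>"
  then obtain t where t: "t \<in> {0..T}" "\<gamma> t \<notin> ball (\<gamma> 0) \<rho>" by blast
  have "continuous_on {0..T} \<gamma>"
    using horizontal_path_imp_curve[OF \<gamma>] by (auto simp: horizontal_curve_def intro: abs_continuous_imp_continuous_on)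
  note cont = this
  let ?E = "{t \<in> {0..T}. \<rho> \<le> dist (\<gamma> 0) (\<gamma> t)}"
  have "closed ?E"
    by (intro continuous_on_closed_Collect_le continuous_intros cont)
  moreover have "bounded ?E" by (rule bounded_subset[OF bounded_closed_interval[of 0 T]]) auto
  ultimately have "compact ?E" by (simp add: compact_eq_bounded_closed)
  moreover have "?E \<noteq> {}" using t by auto
  \<comment> \<open>the first exit time from the open ball\<close>
  ultimately have "\<exists>\<tau>\<in>?E. \<forall>s\<in>?E. \<tau> \<le> s" by (rule compact_attains_inf)
  then obtain \<tau> where \<tau>: "\<tau> \<in> ?E" "\<forall>s\<in>?E. \<tau> \<le> s" by (elim bexE) (rule that)
  have "\<tau> \<noteq> 0" using \<tau>(1) \<open>\<rho> > 0\<close> by auto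
  then have "0 < \<tau>" "\<tau> \<le> T" using \<tau>(1) by auto
  have "\<gamma> ` {0..<\<tau>} \<subseteq> cball (\<gamma> 0) \<rho>"
  proof clarify
    fix s assume "s \<in> {0..<\<tau>}"
    then show "\<gamma> s \<in> cball (\<gamma> 0) \<rho>" using \<tau>(2)[rule_format, of s] \<open>\<tau> \<le> T\<close> by fastforce
  qed
  then have "\<gamma> ` closure {0..<\<tau>} \<subseteq> cball (\<gamma> 0) \<rho>"
    by (rule image_closure_subset[rotated 2])
      (use \<open>0 < \<tau>\<close> \<open>\<tau> \<le> T\<close> in \<open>auto intro: continuous_on_subset[OF cont]\<close>)
  then have im: "\<gamma> ` {0..\<tau>} \<subseteq> cball (\<gamma> 0) \<rho>" using \<open>0 < \<tau>\<close> by simp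
  have sub: "horizontal_path Y \<tau> \<gamma> a"
    by (rule horizontal_path_subpath[OF \<gamma>]) (use \<open>0 < \<tau>\<close> \<open>\<tau> \<le> T\<close> in auto)
  then have curve: "horizontal_curve Y \<tau> \<gamma> a" by (rule horizontal_path_imp_curve)
  let ?I = "LINT t|lebesgue_on {0<..<\<tau>}. norm (a t)"
  have "?I \<le> \<tau>"
  proof -
    have "((\<lambda>t. norm (a t)) has_integral ?I) {0..\<tau>}"
      by (rule has_integral_LINT_Ioo[OF horizontal_curve_control_integrable[OF curve]])
    moreover have "((\<lambda>t. 1::real) has_integral \<tau>) {0..\<tau>}"
      using has_integral_const_real[of "1::real" 0 \<tau>] \<open>0 < \<tau>\<close> by simp
    ultimately show ?thesis
      by (rule has_integral_le) (use \<gamma> in \<open>simp add: horizontal_path_def\<close>)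
  qed
  have "0 \<le> B i" for i by (rule order_trans[OF norm_ge_zero B[of "\<gamma> 0"]]) (use \<open>\<rho> > 0\<close> in simp)
  then have pos: "0 \<le> (\<Sum>i\<in>UNIV. B i)" by (simp add: sum_nonneg)
  have "\<rho> \<le> norm (\<gamma> \<tau> - \<gamma> 0)" using \<tau>(1) by (simp add: dist_norm norm_minus_commute)
  also have "\<dots> \<le> (\<Sum>i\<in>UNIV. B i) * ?I"
    by (rule horizontal_displacement_le_length[OF curve \<open>0 < \<tau>\<close> im B])
  also have "\<dots> \<le> (\<Sum>i\<in>UNIV. B i) * T"
    using pos \<open>?I \<le> \<tau>\<close> \<open>\<tau> \<le> T\<close> by (intro mult_left_mono) auto
  finally show False using T by simp
qed

lemma horizontal_path_connectable:
  assumes \<gamma>: "horizontal_path Y T \<gamma> a" and im: "\<gamma> ` {0..T} \<subseteq> \<Omega>" and ne: "\<gamma> 0 \<noteq> \<gamma> T"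
  shows "connectable Y \<Omega> (\<gamma> 0) (\<gamma> T)"
proof -
  have "T \<noteq> 0" using ne by auto
  then have "T > 0" using \<gamma> by (simp add: horizontal_path_def)
  have "horizontal_curve Y (T / T) (\<lambda>t. \<gamma> (T * t)) (\<lambda>t. T *\<^sub>R a (T * t))"
    by (rule horizontal_curve_rescale[OF horizontal_path_imp_curve[OF \<gamma>] \<open>T > 0\<close>])
  moreover have "(\<lambda>t. \<gamma> (T * t)) ` {0..1} \<subseteq> \<Omega>"
    using im \<open>T > 0\<close> by (auto simp: mult_le_cancel_left1 image_subset_iff)
  ultimately show ?thesis
    unfolding connectable_def using \<open>T > 0\<close>
    by (intro exI[of _ "\<lambda>t. \<gamma> (T * t)"] exI[of _ "\<lambda>t. T *\<^sub>R a (T * t)"]) simp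
qed

section \<open>Accessibility by horizontal paths\<close>

context carnot_group
begin

text \<open>The integral curve of a basis field through the identity; it exists because the coordinates are exponential.\<close>

definition flow :: "'n \<Rightarrow> real \<Rightarrow> real^'n" where
  "flow j = (SOME c. c 0 = \<one> \<and> (\<forall>t. (c has_vector_derivative X j (c t)) (at t)))"

lemma flow_zero [simp]: "flow j 0 = \<one>"
  and flow_has_vector_derivative: "(flow j has_vector_derivative X j (flow j t)) (at t)"
proof -
  have "(\<Sum>i\<in>UNIV. axis j (1::real) $ i *\<^sub>R X i x) = X j x" for x
    by (subst sum.remove[of _ j]) (auto simp: axis_def intro!: sum.neutral)
  then have ex: "\<exists>c. c 0 = \<one> \<and> (\<forall>t. (c has_vector_derivative X j (c t)) (at t))"
    using exponential_coordinates[of "axis j 1"] unfolding is_exp_def by auto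
  have "flow j 0 = \<one> \<and> (\<forall>t. (flow j has_vector_derivative X j (flow j t)) (at t))"
    unfolding flow_def by (rule someI_ex[OF ex])
  then show "flow j 0 = \<one>" "(flow j has_vector_derivative X j (flow j t)) (at t)" by auto
qed

lemma basis_left_invariant: "X j \<in> left_invariant_fields G"
  using basis_span vf.span_base[of "X j" "range X"] by auto

lemma continuous_on_flow: "continuous_on S f \<Longrightarrow> continuous_on S (\<lambda>x. flow j (f x))"
proof -
  have "continuous_on UNIV (flow j)"
    using flow_has_vector_derivative by (meson continuous_at_imp_continuous_on has_vector_derivative_continuous)
  then show "continuous_on S f \<Longrightarrow> continuous_on S (\<lambda>x. flow j (f x))"
    by (rule continuous_on_compose2) auto
qed

lemma translated_flow_has_vector_derivative:
  "((\<lambda>t. g \<otimes> flow j (s + r * t)) has_vector_derivative r *\<^sub>R X j (g \<otimes> flow j (s + r * t))) (at t)"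
proof -
  have "((\<lambda>t. s + r * t) has_vector_derivative r) (at t)"
    by (auto intro!: derivative_eq_intros simp: has_vector_derivative_def)
  from vector_diff_chain_at[OF this flow_has_vector_derivative]
  have "((\<lambda>t. flow j (s + r * t)) has_vector_derivative r *\<^sub>R X j (flow j (s + r * t))) (at t)"
    by (simp add: o_def)
  then show ?thesis by (rule translate_integral_curve[OF basis_left_invariant])
qed

lemma horizontal_path_flow:
  fixes r :: real
  assumes "0 \<le> T" and r: "\<bar>r\<bar> \<le> 1"
  shows "horizontal_path (\<lambda>i. X (h i)) T (\<lambda>t. g \<otimes> flow (h i) (s + r * t)) (\<lambda>_. r *\<^sub>R axis i 1)"
proof -
  let ?\<gamma> = "\<lambda>t. g \<otimes> flow (h i) (s + r * t)"
  let ?d = "\<lambda>t. r *\<^sub>R X (h i) (?\<gamma> t)"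
  have "continuous_on {0..T} ?d"
    by (intro continuous_on_compose2[OF smooth_imp_continuous_on[OF left_invariant_smooth[OF basis_left_invariant], of UNIV]]
        continuous_on_mult_group continuous_on_flow continuous_intros) auto
  then have "bounded (?d ` {0..T})" by (intro compact_imp_bounded compact_continuous_image compact_Icc)
  then obtain L where L: "L > 0" "\<And>t. t \<in> {0..T} \<Longrightarrow> norm (?d t) \<le> L"
    by (auto simp: bounded_pos)
  have "L-lipschitz_on {0..T} ?\<gamma>"
  proof (rule bounded_derivative_imp_lipschitz)
    show "(?\<gamma> has_derivative (\<lambda>x. x *\<^sub>R ?d t)) (at t within {0..T})" for t
      using translated_flow_has_vector_derivative[of g "h i" s r t]
      by (auto simp: has_vector_derivative_def intro: has_derivative_at_withinI)
    show "onorm (\<lambda>x. x *\<^sub>R ?d t) \<le> L" if "t \<in> {0..T}" for t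
      using onorm_scaleR_left[OF bounded_linear_ident, of "?d t"] L(2)[OF that] by (simp add: onorm_id)
  qed (use L in auto)
  moreover have "(\<Sum>i'\<in>UNIV. (r *\<^sub>R axis i 1) $ i' *\<^sub>R X (h i') x) = r *\<^sub>R X (h i) x" for x
    by (subst sum.remove[of _ i]) (auto simp: axis_def intro!: sum.neutral)
  ultimately show ?thesis
    unfolding horizontal_path_def using assms translated_flow_has_vector_derivative
    by (auto intro!: exI[of _ L] exI[of _ "{}"])
qed

text \<open>Group elements that are products of elementary steps along the first layer, with their total duration. A step
  runs along one integral curve from time \<open>s\<close> to time \<open>t\<close>; allowing arbitrary \<open>s\<close> makes the inverse of a step
  again a step.\<close>

inductive reach :: "real \<Rightarrow> real^'n \<Rightarrow> bool" where
  reach_one: "reach 0 \<one>"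
| reach_step: "reach r g \<Longrightarrow> reach (r + \<bar>t - s\<bar>) (g \<otimes> (inv (flow (h i) s) \<otimes> flow (h i) t))"

lemma reach_mult: "reach r' g' \<Longrightarrow> reach r g \<Longrightarrow> reach (r + r') (g \<otimes> g')"
proof (induction rule: reach.induct)
  case reach_one
  then show ?case by simp
next
  case (reach_step r' g' t s i)
  from reach.reach_step[OF reach_step.IH[OF reach_step.prems], of t s i] show ?case
    by (simp add: m_assoc add.assoc)
qed

lemma reach_single: "reach \<bar>t - s\<bar> (inv (flow (h i) s) \<otimes> flow (h i) t)"
  using reach_step[OF reach_one, of t s i] by simp

lemma reach_flow: "reach \<bar>t\<bar> (flow (h i) t)"
  using reach_single[of t 0 i] by simp

lemma reach_inv: "reach r g \<Longrightarrow> reach r (inv g)"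
proof (induction rule: reach.induct)
  case reach_one
  then show ?case using reach.reach_one by simp
next
  case (reach_step r g t s i)
  from reach_mult[OF reach_step.IH reach_single[of s t i]] show ?case
    by (simp add: inv_mult_group abs_minus_commute add.commute)
qed

text \<open>Left translation by \<open>x\<close> carries the steps from the identity to steps from \<open>x\<close>, since the fields are
  left-invariant.\<close>

lemma reach_path:
  "reach r g \<Longrightarrow> \<exists>\<gamma> a. horizontal_path (\<lambda>i. X (h i)) r \<gamma> a \<and> \<gamma> 0 = x \<and> \<gamma> r = x \<otimes> g"
proof (induction rule: reach.induct)
  case reach_one
  show ?case using horizontal_path_const[of _ x] by (intro exI[of _ "\<lambda>_. x"] exI) auto
next
  case (reach_step r g t s i)
  let ?Y = "\<lambda>i. X (h i)"
  from reach_step.IH obtain \<gamma> a where \<gamma>: "horizontal_path ?Y r \<gamma> a" "\<gamma> 0 = x" "\<gamma> r = x \<otimes> g" by blast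
  let ?g = "x \<otimes> g \<otimes> inv (flow (h i) s)" and ?T = "\<bar>t - s\<bar>"
  let ?\<eta> = "\<lambda>\<tau>. ?g \<otimes> flow (h i) (s + sgn (t - s) * \<tau>)"
  have \<eta>: "horizontal_path ?Y ?T ?\<eta> (\<lambda>_. sgn (t - s) *\<^sub>R axis i 1)"
    by (rule horizontal_path_flow) (auto simp: sgn_real_def)
  have "s + sgn (t - s) * ?T = t" by (simp add: sgn_mult_abs)
  then have ends: "?\<eta> 0 = x \<otimes> g" "?\<eta> ?T = x \<otimes> (g \<otimes> (inv (flow (h i) s) \<otimes> flow (h i) t))"
    by (simp_all add: m_assoc)
  have r: "0 \<le> r" using \<gamma>(1) by (simp add: horizontal_path_def)
  from horizontal_path_concat[OF \<gamma>(1) \<eta>] \<gamma>(3) ends(1)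
  have "horizontal_path ?Y (r + ?T) (\<lambda>\<tau>. if \<tau> \<le> r then \<gamma> \<tau> else ?\<eta> (\<tau> - r))
      (\<lambda>\<tau>. if \<tau> \<le> r then a \<tau> else sgn (t - s) *\<^sub>R axis i 1)" by simp
  moreover have "(if r + ?T \<le> r then \<gamma> (r + ?T) else ?\<eta> (r + ?T - r)) =
      x \<otimes> (g \<otimes> (inv (flow (h i) s) \<otimes> flow (h i) t))"
  proof (cases "t = s")
    case True then show ?thesis using \<gamma>(3) by (simp add: m_assoc)
  next
    case False
    then have "\<not> r + ?T \<le> r" by simp
    then show ?thesis using ends(2) by simp
  qed
  moreover have "(if 0 \<le> r then \<gamma> 0 else ?\<eta> (0 - r)) = x" using r \<gamma>(2) by simp
  ultimately show ?case
    by (intro exI[of _ "\<lambda>\<tau>. if \<tau> \<le> r then \<gamma> \<tau> else ?\<eta> (\<tau> - r)"]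
      exI[of _ "\<lambda>\<tau>. if \<tau> \<le> r then a \<tau> else sgn (t - s) *\<^sub>R axis i 1"]) (intro conjI)
qed

text \<open>A left-invariant field is determined by its value at the identity, so the independent basis fields have
  independent values there; there are as many of them as the dimension.\<close>

lemma basis_values_span:
  assumes "\<And>j. \<xi> \<bullet> X j \<one> = 0"
  shows "\<xi> = 0"
proof -
  let ?T = "\<lambda>y::real^'n. \<Sum>j\<in>UNIV. y $ j *\<^sub>R X j \<one>"
  have lin: "linear ?T"
    by (auto intro!: linearI simp: sum.distrib scaleR_add_left scaleR_sum_right)
  have "inj ?T"
    unfolding linear_injective_0[OF lin]
  proof (intro allI impI)
    fix y assume y: "?T y = 0"
    let ?V = "\<Sum>j\<in>UNIV. vf_scale (y $ j) (X j)"
    have app: "(\<Sum>j\<in>A. vf_scale (y $ j) (X j)) x = (\<Sum>j\<in>A. y $ j *\<^sub>R X j x)" for A :: "'n set" and x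
      by (induction A rule: infinite_finite_induct) (auto simp: vf_scale_def)
    have "?V \<in> vf.span (range X)"
      by (intro vf.span_sum vf.span_scale vf.span_base) auto
    then have "?V = 0"
      using y left_invariant_zero[of ?V] basis_span app by simp
    moreover have "?V = (\<Sum>V\<in>range X. vf_scale (y $ the_inv X V) V)"
      by (subst sum.reindex[OF basis_inj]) (simp add: the_inv_f_f[OF basis_inj])
    ultimately have "y $ the_inv X V = 0" if "V \<in> range X" for V
      using vf.independentD[OF basis_independent, of "range X" "\<lambda>V. y $ the_inv X V" V] that by simp
    then have "y $ j = 0" for j using the_inv_f_f[OF basis_inj, of j] by (metis rangeI)
    then show "y = 0" by (simp add: vec_eq_iff)
  qed
  then have "surj ?T" using linear_injective_imp_surjective[OF lin] by simp
  then obtain y where y: "\<xi> = ?T y" by (rule surjE)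
  have "\<xi> \<bullet> \<xi> = \<xi> \<bullet> ?T y" using y by simp
  also have "\<dots> = 0" by (simp add: inner_sum_right assms)
  finally show ?thesis by simp
qed

lemma first_layer_horizontal: "w j = 1 \<Longrightarrow> \<exists>i. j = h i"
proof -
  assume "w j = 1"
  then have "j \<in> range h" using bij_betw_imp_surj_on[OF first_layer_enum] by simp
  then show "\<exists>i. j = h i" by auto
qed

lemma layer_left_invariant: "V \<in> layer i \<Longrightarrow> V \<in> left_invariant_fields G"
  using vf.span_mono[of "X ` {j. w j = i}" "range X"] basis_span by (auto simp: layer_def)

lemma lie_bracket_linear_left:
  assumes V: "V differentiable (at x)" and Z: "Z differentiable (at x)" and W: "W differentiable (at x)"
  shows "lie_bracket (vf_scale c Z + V) W x = c *\<^sub>R lie_bracket Z W x + lie_bracket V W x"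
proof -
  have lin: "linear (frechet_derivative W (at x))"
    using W by (simp add: linear_frechet_derivative)
  have "((\<lambda>y. c *\<^sub>R Z y + V y) has_derivative
      (\<lambda>u. c *\<^sub>R frechet_derivative Z (at x) u + frechet_derivative V (at x) u)) (at x)"
    using V Z by (auto intro!: derivative_eq_intros simp: frechet_derivative_works)
  then have "frechet_derivative (vf_scale c Z + V) (at x) =
      (\<lambda>u. c *\<^sub>R frechet_derivative Z (at x) u + frechet_derivative V (at x) u)"
    using frechet_derivative_at by (metis (no_types, lifting) ext plus_fun_apply vf_scale_def)
  then show ?thesis
    by (simp add: lie_bracket_def vf_scale_def linear_add[OF lin] linear_scale[OF lin] scaleR_diff_right)
qed

text \<open>The bound on the duration is strict, so a short step along any first-layer flow stays within it; this is what
  allows differentiation along these flows. Layers are generated by brackets with the first layer, so the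
  claim ascends from one layer to the next.\<close>

lemma annihilates_layer:
  assumes \<xi>: "\<And>r g i. reach r g \<Longrightarrow> r < \<epsilon> \<Longrightarrow> right_form \<xi> g (X (h i) g) = 0"
    and "1 \<le> i"
  shows "i \<le> k \<Longrightarrow> V \<in> layer i \<Longrightarrow> reach r g \<Longrightarrow> r < \<epsilon> \<Longrightarrow> right_form \<xi> g (V g) = 0"
  using assms(2)
proof (induction i arbitrary: V r g rule: dec_induct)
  case base
  from \<open>V \<in> layer 1\<close> have "V \<in> vf.span (X ` {j. w j = 1})" by (simp add: layer_def)
  then show ?case
  proof (induction rule: vf.span_induct_alt)
    case base
    then show ?case by (simp add: linear_0[OF linear_right_form])
  next
    case (step c Z V)
    then obtain j where j: "Z = X j" "j \<in> {j. w j = 1}" by blast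
    then obtain i where "Z = X (h i)" using first_layer_horizontal[of j] by auto
    then show ?case using step \<xi>[OF base.prems(3,4), of i]
      by (simp add: vf_scale_def linear_add[OF linear_right_form] linear_scale[OF linear_right_form])
  qed
next
  case (step i)
  note IH = step.IH
  have "reach r g" "r < \<epsilon>" "i < k" using step.prems step.hyps by auto
  have bracket: "right_form \<xi> g (lie_bracket V W g) = 0" if V: "V \<in> layer 1" and W: "W \<in> layer i" for V W
  proof -
    note smW = left_invariant_smooth[OF layer_left_invariant[OF W]]
    have diffW: "W differentiable (at g)" using smooth_imp_C1(1)[OF smW] by (auto simp: differentiable_def)
    have "V differentiable (at g) \<and> right_form \<xi> g (lie_bracket V W g) = 0"
      using V[unfolded layer_def]
    proof (induction rule: vf.span_induct_alt)
      case base
      have "linear (frechet_derivative W (at g))" using diffW by (simp add: linear_frechet_derivative)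
      then show ?case
        by (simp add: lie_bracket_def zero_fun_def linear_0 linear_0[OF linear_right_form])
    next
      case (step c Z V)
      then obtain j where j: "Z = X j" "j \<in> {j. w j = 1}" by blast
      then obtain i' where Z: "Z = X (h i')" using first_layer_horizontal[of j] by auto
      have smZ: "smooth Z" unfolding Z by (rule left_invariant_smooth[OF basis_left_invariant])
      have diffZ: "Z differentiable (at g)" using smooth_imp_C1(1)[OF smZ] by (auto simp: differentiable_def)
      have "right_form \<xi> g (lie_bracket Z W g) = 0"
        unfolding Z
      proof (rule right_form_lie_bracket[OF basis_left_invariant smW flow_zero flow_has_vector_derivative])
        show "\<epsilon> - r > 0" using \<open>r < \<epsilon>\<close> by simp
        fix t assume t: "0 \<le> t" "t < \<epsilon> - r"
        have "reach (r + \<bar>t\<bar>) (g \<otimes> flow (h i') t)" by (rule reach_mult[OF reach_flow \<open>reach r g\<close>])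
        then show "right_form \<xi> (g \<otimes> flow (h i') t) (W (g \<otimes> flow (h i') t)) = 0"
          using t \<open>i < k\<close> W by (intro IH) auto
      qed
      moreover have "(vf_scale c Z + V) differentiable (at g)"
        using step diffZ by (auto simp: vf_scale_def plus_fun_def intro!: differentiable_add differentiable_scaleR)
      moreover have "lie_bracket (vf_scale c Z + V) W g = c *\<^sub>R lie_bracket Z W g + lie_bracket V W g"
        using step diffZ diffW by (intro lie_bracket_linear_left) auto
      moreover have "right_form \<xi> g (lie_bracket V W g) = 0" using step by simp
      ultimately show ?case
        by (simp only: linear_add[OF linear_right_form] linear_scale[OF linear_right_form]) simp
    qed
    then show ?thesis by simp
  qed
  have "V \<in> bracket_span (layer 1) (layer i)" using step layer_step[of i] by simp
  then show ?case
    unfolding bracket_span_def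
  proof (induction rule: vf.span_induct_alt)
    case base
    then show ?case by (simp add: linear_0[OF linear_right_form])
  next
    case (step c Z V)
    then have "right_form \<xi> g (Z g) = 0" using bracket by auto
    then show ?case using step
      by (simp add: vf_scale_def linear_add[OF linear_right_form] linear_scale[OF linear_right_form])
  qed
qed

text \<open>Each of these vectors is the velocity at \<open>0\<close> of a curve \<open>g c(t) g\<^sup>-\<^sup>1\<close> that stays in the set of short products. A
  covector orthogonal to all of them annihilates all layers.\<close>

lemma reach_directions_span:
  assumes "\<epsilon> > 0"
  shows "span {right_deriv (inv g) g (X (h i) g) |g i r. reach r g \<and> r < \<epsilon>} = UNIV" (is "span ?B = _")
proof (rule ccontr)
  assume "span ?B \<noteq> UNIV"
  then have "dim ?B < DIM(real^'n)"
    using dim_eq_full[of ?B] dim_subset_UNIV[of ?B] by linarith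
  then obtain \<xi> where \<xi>: "\<xi> \<noteq> 0" "\<And>y. y \<in> span ?B \<Longrightarrow> orthogonal \<xi> y"
    using that by (rule orthogonal_to_subspace_exists)
  have "\<xi> \<bullet> X j \<one> = 0" for j
  proof -
    have "right_form \<xi> \<one> (X j \<one>) = 0"
    proof (rule annihilates_layer[where i = "w j"])
      show "X j \<in> layer (w j)" by (auto simp: layer_def intro: vf.span_base)
      show "reach 0 \<one>" by (rule reach_one)
      fix r g i assume "reach r g" "r < \<epsilon>"
      then have "right_deriv (inv g) g (X (h i) g) \<in> span ?B" by (blast intro: span_base)
      then show "right_form \<xi> g (X (h i) g) = 0" using \<xi>(2) by (simp add: right_form_def orthogonal_def)
    qed (use layer_range[of j] \<open>\<epsilon> > 0\<close> in auto)
    then show ?thesis by (simp add: right_form_def)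
  qed
  then show False using basis_values_span \<xi>(1) by blast
qed

lemma conjugated_flow:
  fixes i :: 'm
  assumes g: "reach r g"
  defines "K \<equiv> \<lambda>t. g \<otimes> flow (h i) t \<otimes> inv g"
  shows "K 0 = \<one>" and "(K has_vector_derivative right_deriv (inv g) g (X (h i) g)) (at 0)"
    and "continuous_on UNIV K" and "reach (2 * r + \<bar>t\<bar>) (K t)"
proof -
  show "K 0 = \<one>" by (simp add: K_def)
  have "((\<lambda>t. g \<otimes> flow (h i) t) has_vector_derivative X (h i) g) (at 0)"
    using translated_flow_has_vector_derivative[of g "h i" 0 1 0] by simp
  then have "(K has_derivative (\<lambda>s. right_deriv (inv g) (g \<otimes> flow (h i) 0) (s *\<^sub>R X (h i) g))) (at 0)"
    unfolding K_def has_vector_derivative_def by (rule has_derivative_compose[OF _ has_derivative_right])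
  then show "(K has_vector_derivative right_deriv (inv g) g (X (h i) g)) (at 0)"
    by (simp add: has_vector_derivative_def linear_scale[OF linear_right_deriv])
  show "continuous_on UNIV K"
    unfolding K_def by (intro continuous_on_mult_group continuous_on_flow continuous_intros)
  have "reach (r + \<bar>t\<bar> + r) (K t)"
    unfolding K_def by (rule reach_mult[OF reach_inv[OF g] reach_mult[OF reach_flow g]])
  then show "reach (2 * r + \<bar>t\<bar>) (K t)" by (simp add: algebra_simps)
qed

text \<open>At the identity the derivative of a product is the sum of the derivatives, so the velocities of the
  factors add up.\<close>

lemma product_of_curves:
  fixes K :: "real^'n \<Rightarrow> real \<Rightarrow> real^'n" and l :: "real^'n \<Rightarrow> real^'n \<Rightarrow> real"
  assumes "\<And>b. b \<in> set bs \<Longrightarrow> K b 0 = \<one>" "\<And>b. b \<in> set bs \<Longrightarrow> (K b has_vector_derivative b) (at 0)"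
    "\<And>b. b \<in> set bs \<Longrightarrow> continuous_on UNIV (K b)"
    "\<And>b t. b \<in> set bs \<Longrightarrow> \<exists>r\<le>\<rho> + \<bar>t\<bar>. reach r (K b t)"
    and l: "\<And>b. bounded_linear (l b)"
  defines "F \<equiv> \<lambda>bs v. foldr (\<lambda>b z. K b (l b v) \<otimes> z) bs \<one>"
  shows "F bs 0 = \<one> \<and> (F bs has_derivative (\<lambda>v. \<Sum>b\<leftarrow>bs. l b v *\<^sub>R b)) (at 0) \<and>
    continuous_on UNIV (F bs) \<and> (\<forall>v. \<exists>r\<le>(\<Sum>b\<leftarrow>bs. \<rho> + \<bar>l b v\<bar>). reach r (F bs v))"
  using assms(1-4)
proof (induction bs)
  case Nil
  show ?case using reach_one by (auto simp: F_def)
next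
  case (Cons b bs)
  have IH: "F bs 0 = \<one>" "(F bs has_derivative (\<lambda>v. \<Sum>b\<leftarrow>bs. l b v *\<^sub>R b)) (at 0)"
    "continuous_on UNIV (F bs)" "\<forall>v. \<exists>r\<le>(\<Sum>b\<leftarrow>bs. \<rho> + \<bar>l b v\<bar>). reach r (F bs v)"
    using Cons by auto
  have F: "F (b # bs) = (\<lambda>v. K b (l b v) \<otimes> F bs v)" by (simp add: F_def fun_eq_iff)
  have l0: "l b 0 = 0" using l by (simp add: linear_simps(3))
  have K0: "K b 0 = \<one>" using Cons.prems(1) by simp
  have "(K b has_derivative (\<lambda>s. s *\<^sub>R b)) (at (l b 0))"
    using Cons.prems(2)[of b] by (simp add: l0 has_vector_derivative_def)
  then have "((\<lambda>v. K b (l b v)) has_derivative (\<lambda>v. l b v *\<^sub>R b)) (at 0)"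
    by (rule has_derivative_compose[OF bounded_linear_imp_has_derivative[OF l]])
  from has_derivative_mult[OF this IH(2)]
  have "(F (b # bs) has_derivative (\<lambda>v. \<Sum>b\<leftarrow>b # bs. l b v *\<^sub>R b)) (at 0)"
    unfolding F by (simp add: mult_deriv_split IH(1) l0 K0)
  moreover have "continuous_on UNIV (\<lambda>v. K b (l b v))"
    using continuous_on_compose2[OF Cons.prems(3)[of b] linear_continuous_on[OF l]] by simp
  then have "continuous_on UNIV (F (b # bs))"
    unfolding F by (intro continuous_on_mult_group IH(3))
  moreover have "\<exists>r\<le>(\<Sum>b\<leftarrow>b # bs. \<rho> + \<bar>l b v\<bar>). reach r (F (b # bs) v)" for v
  proof -
    obtain r where r: "r \<le> \<rho> + \<bar>l b v\<bar>" "reach r (K b (l b v))" using Cons.prems(4)[of b "l b v"] by auto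
    obtain r' where r': "r' \<le> (\<Sum>b\<leftarrow>bs. \<rho> + \<bar>l b v\<bar>)" "reach r' (F bs v)" using IH(4) by blast
    show ?thesis
      using reach_mult[OF r'(2) r(2)] r(1) r'(1) unfolding F by (intro exI[of _ "r + r'"]) auto
  qed
  moreover have "F (b # bs) 0 = \<one>" unfolding F by (simp add: l0 K0 IH(1))
  ultimately show ?case by blast
qed

text \<open>Coordinates with respect to a basis of velocities of conjugated curves serve as their times. The
  resulting product map has the identity as derivative at \<open>0\<close>, so its image of a small neighbourhood of \<open>0\<close> is a
  neighbourhood of the group identity.\<close>

theorem reach_neighbourhood:
  assumes "\<epsilon> > 0"
  shows "\<exists>\<delta>>0. \<forall>g\<in>ball \<one> \<delta>. \<exists>r<\<epsilon>. reach r g"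
proof -
  \<comment> \<open>each of at most \<open>DIM\<close> factors costs less than \<open>3 * e\<close>: conjugation \<open>2 * e\<close> and the curve itself \<open>e\<close>\<close>
  define e where "e = \<epsilon> / (4 * real DIM(real^'n))"
  have "e > 0" using \<open>\<epsilon> > 0\<close> by (simp add: e_def)
  let ?V = "{right_deriv (inv g) g (X (h i) g) |g i r. reach r g \<and> r < e}"
  obtain B where B: "B \<subseteq> ?V" "independent B" "?V \<subseteq> span B" using that by (rule real_vector.maximal_independent_subset)
  have "span ?V \<subseteq> span B" using B(3) by (rule span_minimal) simp
  then have spanB: "span B = UNIV" using reach_directions_span[OF \<open>e > 0\<close>] by auto
  have finB: "finite B" "card B \<le> DIM(real^'n)" using independent_bound[OF B(2)] by auto
  have "\<exists>K. K 0 = \<one> \<and> (K has_vector_derivative b) (at 0) \<and> continuous_on UNIV K \<and>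
      (\<forall>t. \<exists>r\<le>2 * e + \<bar>t\<bar>. reach r (K t))" if b: "b \<in> B" for b
  proof -
    obtain g i r where b: "b = right_deriv (inv g) g (X (h i) g)" and g: "reach r g" "r < e"
      using B(1) b by auto
    have "\<exists>r\<le>2 * e + \<bar>t\<bar>. reach r (g \<otimes> flow (h i) t \<otimes> inv g)" for t
      using conjugated_flow(4)[OF g(1), where i = i and t = t] g(2) by (intro exI[of _ "2 * r + \<bar>t\<bar>"]) auto
    then show ?thesis
      unfolding b
      by (intro exI[of _ "\<lambda>t. g \<otimes> flow (h i) t \<otimes> inv g"] conjI allI conjugated_flow(1-3)[OF g(1)])
  qed
  then obtain K where K: "\<And>b. b \<in> B \<Longrightarrow> K b 0 = \<one>" "\<And>b. b \<in> B \<Longrightarrow> (K b has_vector_derivative b) (at 0)"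
    "\<And>b. b \<in> B \<Longrightarrow> continuous_on UNIV (K b)" "\<And>b t. b \<in> B \<Longrightarrow> \<exists>r\<le>2 * e + \<bar>t\<bar>. reach r (K b t)"
    by metis
  define l where "l b v = representation B v b" for b v
  have l: "bounded_linear (l b)" for b
    unfolding linear_conv_bounded_linear[symmetric] l_def
    by (rule linearI)
      (simp_all add: real_vector.representation_add[OF B(2)] real_vector.representation_scale[OF B(2)] spanB)
  obtain bs where bs: "set bs = B" "distinct bs" using finite_distinct_list[OF finB(1)] by blast
  let ?F = "\<lambda>v. foldr (\<lambda>b z. K b (l b v) \<otimes> z) bs \<one>"
  have F: "?F 0 = \<one>" "(?F has_derivative (\<lambda>v. \<Sum>b\<leftarrow>bs. l b v *\<^sub>R b)) (at 0)" "continuous_on UNIV ?F"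
    "\<And>v. \<exists>r\<le>(\<Sum>b\<leftarrow>bs. 2 * e + \<bar>l b v\<bar>). reach r (?F v)"
    using product_of_curves[of bs K "2 * e" l, OF _ _ _ _ l] K bs(1) by auto
  have "(\<Sum>b\<leftarrow>bs. l b v *\<^sub>R b) = v" for v
    using real_vector.sum_representation_eq[OF B(2) _ finB(1) order_refl, of v] spanB bs
    by (simp add: sum_list_distinct_conv_sum_set l_def)
  then have dF: "(?F has_derivative id) (at 0)" using F(2) by (simp add: id_def)
  let ?U = "{v. \<forall>b\<in>B. \<bar>l b v\<bar> < e}"
  have "?U = (\<Inter>b\<in>B. {v. \<bar>l b v\<bar> < e})" by auto
  moreover have "open {v. \<bar>l b v\<bar> < e}" for b
    by (intro open_Collect_less continuous_intros linear_continuous_on l)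
  ultimately have "open ?U" using finB(1) by (metis (no_types, lifting) open_INT)
  moreover have "0 \<in> ?U" using \<open>e > 0\<close> l by (simp add: linear_simps(3))
  ultimately have "0 \<in> interior ?U" by (simp add: interior_open)
  then have "?F 0 \<in> interior (?F ` ?U)"
    by (intro sussmann_open_mapping[OF open_UNIV F(3) _ dF bounded_linear_ident]) (auto simp: id_def o_def)
  then have "\<one> \<in> interior (?F ` ?U)" by (simp only: F(1))
  then obtain \<delta> where "\<delta> > 0" "ball \<one> \<delta> \<subseteq> ?F ` ?U" unfolding mem_interior by blast
  moreover have "\<exists>r<\<epsilon>. reach r (?F v)" if v: "v \<in> ?U" for v
  proof -
    obtain r where r: "r \<le> (\<Sum>b\<leftarrow>bs. 2 * e + \<bar>l b v\<bar>)" "reach r (?F v)" using F(4) by blast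
    have "(\<Sum>b\<leftarrow>bs. 2 * e + \<bar>l b v\<bar>) = (\<Sum>b\<in>B. 2 * e + \<bar>l b v\<bar>)"
      using bs by (simp add: sum_list_distinct_conv_sum_set)
    also have "\<dots> \<le> (\<Sum>b\<in>B. 3 * e)" using v by (intro sum_mono) force
    also have "\<dots> \<le> real DIM(real^'n) * (3 * e)"
      using finB(2) \<open>e > 0\<close> by (simp del: DIM_cart) 
    also have "\<dots> < \<epsilon>" using \<open>\<epsilon> > 0\<close> by (simp add: e_def field_simps)
    finally show ?thesis using r by (intro exI[of _ r]) auto
  qed
  ultimately show ?thesis by (intro exI[of _ \<delta>]) blast
qed

text \<open>Short products of steps reach a whole neighbourhood of \<open>x\<close>, and paths of short duration do not leave a
  ball around \<open>x\<close> that is contained in \<open>\<Omega>\<close>.\<close>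

theorem connectable_nearby:
  assumes "open \<Omega>" "x \<in> \<Omega>"
  shows "\<exists>\<delta>>0. \<forall>y. y \<noteq> x \<longrightarrow> dist y x < \<delta> \<longrightarrow> connectable (\<lambda>i. X (h i)) \<Omega> x y"
proof -
  let ?Y = "\<lambda>i. X (h i)"
  obtain \<rho> where \<rho>: "\<rho> > 0" "cball x \<rho> \<subseteq> \<Omega>" using assms by (auto simp: open_contains_cball)
  have "\<exists>B. \<forall>z\<in>cball x \<rho>. norm (?Y i z) \<le> B" for i
    using compact_imp_bounded[OF compact_continuous_image[OF smooth_imp_continuous_on[OF
      left_invariant_smooth[OF basis_left_invariant]] compact_cball]] by (auto simp: bounded_iff)
  then obtain B where B: "\<And>i z. z \<in> cball x \<rho> \<Longrightarrow> norm (?Y i z) \<le> B i" by metis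
  define M where "M = (\<Sum>i\<in>UNIV. B i) + 1"
  have "0 \<le> B i" for i by (rule order_trans[OF norm_ge_zero B[of x]]) (use \<rho> in simp)
  then have M: "M > 0" "(\<Sum>i\<in>UNIV. B i) \<le> M" by (auto simp: M_def intro!: add_nonneg_pos sum_nonneg)
  obtain \<delta> where \<delta>: "\<delta> > 0" "\<forall>g\<in>ball \<one> \<delta>. \<exists>r<\<rho> / M. reach r g"
    using reach_neighbourhood[of "\<rho> / M"] \<rho> M by auto
  have "continuous_on UNIV (\<lambda>y. inv x \<otimes> y)"
    by (intro continuous_on_mult_group continuous_intros)
  then obtain \<eta> where \<eta>: "\<eta> > 0" "\<forall>y. dist y x < \<eta> \<longrightarrow> dist (inv x \<otimes> y) (inv x \<otimes> x) < \<delta>"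
    using \<open>\<delta> > 0\<close> unfolding continuous_on_iff by (metis UNIV_I)
  have "connectable ?Y \<Omega> x y" if "y \<noteq> x" "dist y x < \<eta>" for y
  proof -
    have "inv x \<otimes> y \<in> ball \<one> \<delta>" using \<eta>(2) that by (simp add: dist_commute)
    then obtain r where r: "r < \<rho> / M" "reach r (inv x \<otimes> y)" using \<delta>(2) by blast
    have "x \<otimes> (inv x \<otimes> y) = y" by (simp add: m_assoc[symmetric])
    then obtain \<gamma> a where \<gamma>: "horizontal_path ?Y r \<gamma> a" "\<gamma> 0 = x" "\<gamma> r = y"
      using reach_path[OF r(2), of x] by auto
    have "0 \<le> r" using \<gamma>(1) by (simp add: horizontal_path_def)
    then have "(\<Sum>i\<in>UNIV. B i) * r \<le> M * r" using M by (intro mult_right_mono)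
    also have "\<dots> < \<rho>" using r(1) M by (simp add: field_simps)
    finally have "\<gamma> ` {0..r} \<subseteq> ball (\<gamma> 0) \<rho>"
      using B \<rho>(1) \<gamma>(2) by (intro horizontal_path_stays_in_ball[OF \<gamma>(1), of \<rho> B]) auto
    also have "ball (\<gamma> 0) \<rho> \<subseteq> cball x \<rho>" unfolding \<gamma>(2) by (rule ball_subset_cball)
    also note \<rho>(2)
    finally have "\<gamma> ` {0..r} \<subseteq> \<Omega>" .
    then show ?thesis using horizontal_path_connectable[OF \<gamma>(1), of \<Omega>] \<gamma>(2,3) \<open>y \<noteq> x\<close> by auto
  qed
  then show ?thesis using \<eta>(1) by blast
qed

end

section \<open>The comparison principle\<close>

text \<open>At a maximum point of \<open>\<theta> u - v\<close> the quotient of \<open>v\<close> is at least \<open>\<theta>\<close> times that of \<open>u\<close> plus \<open>1 - \<theta>\<close> times the quotient of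
  the distances, and the latter is bounded below by \<open>1 / \<alpha>\<close>.\<close>

lemma Liminf_monge_quotient_pos:
  fixes Y :: "'m::finite \<Rightarrow> 'n::finite vfield"
  assumes H: "hamiltonian_H \<Omega> H" and B: "\<And>i z. z \<in> \<Omega> \<Longrightarrow> norm (Y i z) \<le> B i"
    and near: "\<delta> > 0" "\<And>y. y \<noteq> x \<Longrightarrow> dist y x < \<delta> \<Longrightarrow> connectable Y \<Omega> x y"
    and sub: "Liminf (at x within \<Omega>) (\<lambda>y. ereal (monge_quotient Y \<Omega> H u x y)) \<ge> 0"
    and \<theta>: "0 < \<theta>" "\<theta> < 1" and min: "\<And>y. y \<in> \<Omega> \<Longrightarrow> \<theta> * u y - v y \<le> \<theta> * u x - v x"
  shows "Liminf (at x within \<Omega>) (\<lambda>y. ereal (monge_quotient Y \<Omega> H v x y)) > 0"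
proof -
  obtain \<alpha> where \<alpha>: "\<alpha> > 1"
    "\<forall>x y. connectable Y \<Omega> x y \<longrightarrow> cc_dist Y \<Omega> x y \<le> \<alpha> * optical_dist Y \<Omega> H x y"
    using cc_dist_le_optical_dist[OF H, of Y] by (elim exE conjE) (rule that)
  define c where "c = (1 - \<theta>) / \<alpha>"
  have "c > 0" using \<theta> \<alpha> by (simp add: c_def)
  have "eventually (\<lambda>y. ereal (- (c / 2)) < ereal (monge_quotient Y \<Omega> H u x y)) (at x within \<Omega>)"
    using sub[unfolded le_Liminf_iff, rule_format, of "ereal (- (c / 2))"] \<open>c > 0\<close> by simp
  moreover have "eventually (\<lambda>y. y \<in> \<Omega> \<and> y \<noteq> x \<and> dist y x < \<delta>) (at x within \<Omega>)"
    using near(1) unfolding eventually_at by blast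
  ultimately have "eventually (\<lambda>y. ereal (c / 2) \<le> ereal (monge_quotient Y \<Omega> H v x y)) (at x within \<Omega>)"
  proof eventually_elim
    case (elim y)
    let ?d = "cc_dist Y \<Omega> x y" and ?o = "optical_dist Y \<Omega> H x y"
    have con: "connectable Y \<Omega> x y" using elim near(2) by blast
    have d: "?d > 0" using cc_dist_pos[OF con _ B] elim by auto
    have "?d \<le> \<alpha> * ?o" using \<alpha>(2) con by blast
    then have "1 / \<alpha> \<le> ?o / ?d" using d \<alpha>(1) by (simp add: field_simps)
    then have "(1 - \<theta>) * (1 / \<alpha>) \<le> (1 - \<theta>) * (?o / ?d)" using \<theta> by (intro mult_left_mono) auto
    then have o: "c \<le> (1 - \<theta>) * (?o / ?d)" by (simp add: c_def)
    have "- (c / 2) \<le> \<theta> * - (c / 2)" using \<theta> \<open>c > 0\<close> by simp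
    also have "\<dots> \<le> \<theta> * monge_quotient Y \<Omega> H u x y" using elim \<theta> by (intro mult_left_mono) auto
    finally have "c / 2 \<le> \<theta> * monge_quotient Y \<Omega> H u x y + (1 - \<theta>) * (?o / ?d)" using o by linarith
    also have "\<dots> = (\<theta> * (u y - u x) + ?o) / ?d"
      using d by (simp add: monge_quotient_def field_simps)
    also have "\<dots> \<le> monge_quotient Y \<Omega> H v x y"
      unfolding monge_quotient_def using min[of y] elim d
      by (intro divide_right_mono) (auto simp: algebra_simps)
    finally show ?case by simp
  qed
  then have "ereal (c / 2) \<le> Liminf (at x within \<Omega>) (\<lambda>y. ereal (monge_quotient Y \<Omega> H v x y))"
    by (rule Liminf_bounded)
  moreover have "0 < ereal (c / 2)" using \<open>c > 0\<close> by simp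
  ultimately show ?thesis by (rule less_le_trans[rotated])
qed

theorem theorem1p4:
  fixes G :: "(real^'n::finite) monoid"
    and k :: nat
    and w :: "'n \<Rightarrow> nat"
    and X :: "'n \<Rightarrow> 'n vfield"
    and h :: "'m::finite \<Rightarrow> 'n"
    and \<Omega> :: "(real^'n) set"
    and H :: "real^'n \<Rightarrow> real^'m \<Rightarrow> real"
    and u v :: "real^'n \<Rightarrow> real"
  assumes "carnot_group G k w X h"
    and "open \<Omega>" and "connected \<Omega>" and "bounded \<Omega>"
    and "hamiltonian_H \<Omega> H"
    and "continuous_on (closure \<Omega>) u"
    and "monge_subsolution (\<lambda>i. X (h i)) \<Omega> H u"
    and "continuous_on (closure \<Omega>) v"
    and "monge_supersolution (\<lambda>i. X (h i)) \<Omega> H v"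
    and "\<forall>x\<in>frontier \<Omega>. u x \<le> v x"
  shows "\<forall>x\<in>\<Omega>. u x \<le> v x"
proof (rule ccontr)
  assume "\<not> (\<forall>x\<in>\<Omega>. u x \<le> v x)"
  then obtain x1 where x1: "x1 \<in> \<Omega>" "v x1 < u x1" by (auto simp: not_le)
  interpret carnot_group G k w X h "\<lambda>i. vf.span (X ` {j. w j = i})" by fact
  let ?Y = "\<lambda>i. X (h i)"
  have comp: "compact (closure \<Omega>)" using assms(4) by simp
  have "\<exists>B. \<forall>z\<in>\<Omega>. norm (?Y i z) \<le> B" for i
  proof -
    have "bounded (?Y i ` closure \<Omega>)"
      by (intro compact_imp_bounded compact_continuous_image comp smooth_imp_continuous_on
          left_invariant_smooth basis_left_invariant)
    then show ?thesis using closure_subset[of \<Omega>] by (auto simp: bounded_iff)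
  qed
  then obtain B where B: "\<And>i z. z \<in> \<Omega> \<Longrightarrow> norm (?Y i z) \<le> B i" by metis
  have "bounded (u ` closure \<Omega>)"
    by (intro compact_imp_bounded compact_continuous_image comp assms)
  then obtain K where K: "K > 0" "\<And>z. z \<in> closure \<Omega> \<Longrightarrow> \<bar>u z\<bar> \<le> K"
    by (auto simp: bounded_pos)
  \<comment> \<open>\<open>1 - s\<close> is the factor \<open>\<theta>\<close>; multiplying \<open>u\<close> by it changes \<open>u\<close> by at most a quarter of \<open>u x1 - v x1\<close>\<close>
  define s where "s = min (1 / 2) ((u x1 - v x1) / (4 * K))"
  have s: "0 < s" "s < 1" using x1 K by (auto simp: s_def)
  have "s \<le> (u x1 - v x1) / (4 * K)" by (simp add: s_def)
  then have sK: "4 * (s * K) \<le> u x1 - v x1" using K by (simp add: field_simps)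
  let ?f = "\<lambda>z. (1 - s) * u z - v z"
  have "continuous_on (closure \<Omega>) ?f" by (intro continuous_intros assms)
  then have "\<exists>x\<in>closure \<Omega>. \<forall>y\<in>closure \<Omega>. ?f y \<le> ?f x"
    using x1 closure_subset by (intro continuous_attains_sup comp) auto
  then obtain x where x: "x \<in> closure \<Omega>" "\<forall>y\<in>closure \<Omega>. ?f y \<le> ?f x" by (elim bexE) (rule that)
  have x1c: "x1 \<in> closure \<Omega>" using x1 closure_subset by blast
  have su: "\<bar>s * u z\<bar> \<le> s * K" if "z \<in> closure \<Omega>" for z
    using K(2)[OF that] s by (simp add: abs_mult)
  have "x \<in> \<Omega>"
  proof (rule ccontr)
    assume "x \<notin> \<Omega>"
    then have "x \<in> frontier \<Omega>" using x(1) \<open>open \<Omega>\<close> by (simp add: frontier_def interior_open)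
    then have "u x \<le> v x" using assms by blast
    have "?f x1 \<le> ?f x" using x(2) x1c by blast
    moreover have "?f x \<le> s * K" using su[OF x(1)] \<open>u x \<le> v x\<close> by (simp add: algebra_simps abs_le_iff)
    moreover have "?f x1 \<ge> 4 * (s * K) - s * K" using su[OF x1c] sK by (simp add: algebra_simps abs_le_iff)
    moreover have "s * K > 0" using s K by simp
    ultimately show False by linarith
  qed
  obtain \<delta> where \<delta>: "\<delta> > 0" "\<forall>y. y \<noteq> x \<longrightarrow> dist y x < \<delta> \<longrightarrow> connectable ?Y \<Omega> x y"
    using connectable_nearby[OF \<open>open \<Omega>\<close> \<open>x \<in> \<Omega>\<close>] by (elim exE conjE) (rule that)
  have "Liminf (at x within \<Omega>) (\<lambda>y. ereal (monge_quotient ?Y \<Omega> H v x y)) > 0"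
  proof (rule Liminf_monge_quotient_pos[OF \<open>hamiltonian_H \<Omega> H\<close> B \<delta>(1)])
    show "Liminf (at x within \<Omega>) (\<lambda>y. ereal (monge_quotient ?Y \<Omega> H u x y)) \<ge> 0"
      using assms(7) \<open>x \<in> \<Omega>\<close> by (simp add: monge_subsolution_def)
    show "connectable ?Y \<Omega> x y" if "y \<noteq> x" "dist y x < \<delta>" for y using \<delta>(2) that by blast
    show "(1 - s) * u y - v y \<le> (1 - s) * u x - v x" if "y \<in> \<Omega>" for y
      using x(2) that closure_subset by blast
  qed (use s in auto)
  moreover have "Liminf (at x within \<Omega>) (\<lambda>y. ereal (monge_quotient ?Y \<Omega> H v x y)) \<le> 0"
    using assms(9) \<open>x \<in> \<Omega>\<close> by (simp add: monge_supersolution_def)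
  ultimately show False by simp
qed

end
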